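(* Let $A,B\in\mathbb{B}(\mathscr{H})$ be positive operators and let $m,m',M,M'$ be positive real numbers satisfying either one of the following conditions: (1) $0<m\le B\le m'<M'\le A\le M$; (2) $0<m\le A\le m'<M'\le B\le M$. Then for every positive unital linear map $\Phi:\mathbb{B}(\mathscr{H})\to\mathbb{B}(\mathscr{K})$ and every $0\le\nu\le 1$, $$\Phi^{2}\big(A\nabla_\nu B+2rMm(A^{-1}\nabla B^{-1}-A^{-1}\sharp B^{-1})\big)\le\left(\frac{K(h)}{K(\sqrt{h'})^{r_1}}\right)^{2}\Phi^{2}(A\sharp_\nu B)$$ and $$\Phi^{2}\big(A\nabla_\nu B+2rMm(A^{-1}\nabla B^{-1}-A^{-1}\sharp B^{-1})\big)\le\left(\frac{K(h)}{K(\sqrt{h'})^{r_1}}\right)^{2}\big(\Phi(A)\sharp_\nu\Phi(B)\big)^{2},$$ where $r=\min\{\nu,1-\nu\}$, $r_1=\min\{2r,1-2r\}$, $h=\frac{M}{m}$, $h'=\frac{M'}{m'}$.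
   Context: $\mathscr{H}$ and $\mathscr{K}$ are complex Hilbert spaces; $\mathbb{B}(\mathscr{H})$ is the $C^*$-algebra of bounded linear operators on $\mathscr{H}$ with identity $I$. For self-adjoint $X,Y$, $X\le Y$ means $Y-X$ is positive, i.e. $\langle (Y-X)x,x\rangle\ge 0$ for all $x$. A scalar $c$ in an operator inequality stands for $cI$. A linear map $\Phi$ is positive if $\Phi(X)\ge0$ whenever $X\ge0$, and unital if $\Phi(I)=I$. $\Phi^{p}(X)$ denotes $(\Phi(X))^{p}$ (functional calculus). For positive invertible $X,Y$ and $0\le\nu\le1$: $X\nabla_\nu Y=(1-\nu)X+\nu Y$ and $X\sharp_\nu Y=X^{1/2}(X^{-1/2}YX^{-1/2})^{\nu}X^{1/2}$; $\nabla$ and $\sharp$ denote $\nabla_{1/2}$ and $\sharp_{1/2}$. The Kantorovich constant is $K(t)=\frac{(1+t)^2}{4t}$ for $t>0$. *)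

theory Defs
  imports "HOL-Analysis.Analysis" "HOL-Computational_Algebra.Polynomial"
begin

section \<open>Complex Hilbert spaces\<close>

class complex_vector = real_vector +
  fixes scaleC :: "complex \<Rightarrow> 'a \<Rightarrow> 'a" (infixr "*\<^sub>C" 75)
  assumes scaleC_add_right: "c *\<^sub>C (x + y) = c *\<^sub>C x + c *\<^sub>C y"
    and scaleC_add_left: "(c + d) *\<^sub>C x = c *\<^sub>C x + d *\<^sub>C x"
    and scaleC_scaleC: "c *\<^sub>C d *\<^sub>C x = (c * d) *\<^sub>C x"
    and scaleC_of_real: "complex_of_real r *\<^sub>C x = r *\<^sub>R x"

lemma scaleC_one: "1 *\<^sub>C x = (x::'a::complex_vector)"
  using scaleC_of_real[of 1 x] by simp

global_interpretation complex_vector: vector_space "scaleC :: complex \<Rightarrow> 'a \<Rightarrow> 'a::complex_vector"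
  by unfold_locales
    (simp_all add: scaleC_add_right scaleC_add_left scaleC_scaleC scaleC_one)

abbreviation clinear :: "('a::complex_vector \<Rightarrow> 'b::complex_vector) \<Rightarrow> bool"
  where "clinear \<equiv> Vector_Spaces.linear scaleC scaleC"

lemma clinear_iff:
  "clinear f \<longleftrightarrow> (\<forall>x y. f (x + y) = f x + f y) \<and> (\<forall>c x. f (c *\<^sub>C x) = c *\<^sub>C f x)"
  unfolding Vector_Spaces.linear_iff by (simp add: complex_vector.vector_space_axioms)

text \<open>The inner product is linear in its first argument; definiteness and the fact that the
  norm is the one induced by the inner product are both contained in the last axiom.\<close>

class complex_inner = complex_vector + real_normed_vector +
  fixes cinner :: "'a \<Rightarrow> 'a \<Rightarrow> complex"
  assumes cinner_commute: "cinner x y = cnj (cinner y x)"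
    and cinner_add_left: "cinner (x + y) z = cinner x z + cinner y z"
    and cinner_scaleC_left: "cinner (c *\<^sub>C x) y = c * cinner x y"
    and cinner_self: "cinner x x = complex_of_real ((norm x)\<^sup>2)"

class chilbert_space = complex_inner + complete_space

instantiation complex :: chilbert_space
begin

definition "scaleC_complex = ((*) :: complex \<Rightarrow> _)"
definition "cinner_complex x y = x * cnj y" for x y :: complex

instance
proof
  fix x :: complex
  show "cinner x x = complex_of_real ((norm x)\<^sup>2)"
    unfolding cinner_complex_def by (rule complex_norm_square[symmetric])
qed (simp_all add: scaleC_complex_def cinner_complex_def algebra_simps scaleR_conv_of_real)

end

lemma cinner_add_right: "cinner x (y + z) = cinner x y + cinner x z"
  by (metis cinner_add_left cinner_commute complex_cnj_add)

lemma cinner_scaleC_right: "cinner x (c *\<^sub>C y) = cnj c * cinner x y"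
  by (metis cinner_scaleC_left cinner_commute complex_cnj_mult)

lemma norm_scaleC: "norm (c *\<^sub>C x) = norm c * norm (x::'a::complex_inner)"
proof -
  have "complex_of_real ((norm (c *\<^sub>C x))\<^sup>2) = c * cnj c * complex_of_real ((norm x)\<^sup>2)"
    unfolding cinner_self[symmetric] cinner_scaleC_left cinner_scaleC_right
    by (simp only: mult_ac)
  also have "\<dots> = complex_of_real ((norm c * norm x)\<^sup>2)"
    by (simp only: complex_norm_square[symmetric] of_real_mult[symmetric] power_mult_distrib)
  finally have "(norm (c *\<^sub>C x))\<^sup>2 = (norm c * norm x)\<^sup>2"
    using of_real_eq_iff by blast
  then show ?thesis
    by (rule power2_eq_imp_eq) simp_all
qed

section \<open>The algebra of bounded operators\<close>

text \<open>The type below consists of the bounded complex-linear operators on a complex inner product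
  space, with composition as product. It is only made an instance of \<^class>\<open>ring\<close> and
  \<^class>\<open>monoid_mult\<close>, not of \<^class>\<open>ring_1\<close>, because the zero space is not excluded.\<close>

typedef (overloaded) 'a bop = "{f :: 'a \<Rightarrow> 'a::complex_inner. clinear f \<and> bounded_linear f}"
  morphisms bop_apply Abs_bop
  by (rule exI[of _ "\<lambda>_. 0"]) (simp add: clinear_iff)

setup_lifting type_definition_bop

lemma bop_eqI: "(\<And>x. bop_apply S x = bop_apply T x) \<Longrightarrow> S = T"
  by transfer auto

lemma bounded_linear_bop_apply: "bounded_linear (bop_apply T)"
  using bop_apply by auto

lemma clinear_bop_apply: "clinear (bop_apply T)"
  using bop_apply by auto

lemma bop_apply_scaleC: "bop_apply T (c *\<^sub>C x) = c *\<^sub>C bop_apply T x"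
  using clinear_bop_apply[of T] by (simp add: clinear_iff)

lemma bop_apply_add: "bop_apply T (x + y) = bop_apply T x + bop_apply T y"
  using clinear_bop_apply[of T] by (simp add: clinear_iff)

lemma bounded_linear_scaleC: "bounded_linear (\<lambda>x::'a::complex_inner. c *\<^sub>C x)"
  by (rule bounded_linear_intro[where K = "norm c"])
    (simp_all add: scaleC_add_right norm_scaleC scaleC_of_real[symmetric] scaleC_scaleC mult.commute)

instantiation bop :: (complex_inner) complex_vector
begin

lift_definition zero_bop :: "'a bop" is "\<lambda>_. 0"
  by (simp add: clinear_iff)
lift_definition plus_bop :: "'a bop \<Rightarrow> 'a bop \<Rightarrow> 'a bop" is "\<lambda>f g x. f x + g x"
  by (simp add: clinear_iff bounded_linear_add scaleC_add_right)
lift_definition scaleC_bop :: "complex \<Rightarrow> 'a bop \<Rightarrow> 'a bop" is "\<lambda>c f x. c *\<^sub>C f x"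
  by (simp add: clinear_iff scaleC_add_right scaleC_scaleC mult.commute
      bounded_linear_compose[OF bounded_linear_scaleC])
lift_definition scaleR_bop :: "real \<Rightarrow> 'a bop \<Rightarrow> 'a bop" is "\<lambda>c f x. c *\<^sub>R f x"
  by (simp add: clinear_iff scaleC_of_real[symmetric] scaleC_add_right scaleC_scaleC mult.commute
      bounded_linear_compose[OF bounded_linear_scaleC])
lift_definition uminus_bop :: "'a bop \<Rightarrow> 'a bop" is "\<lambda>f x. - f x"
  by (simp add: clinear_iff bounded_linear_minus complex_vector.scale_minus_right)
lift_definition minus_bop :: "'a bop \<Rightarrow> 'a bop \<Rightarrow> 'a bop" is "\<lambda>f g x. f x - g x"
  by (simp add: clinear_iff bounded_linear_sub complex_vector.scale_right_diff_distrib)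

instance
  by standard
    (transfer; simp add: fun_eq_iff algebra_simps scaleC_add_right scaleC_add_left scaleC_scaleC
      scaleC_of_real)+

end

instantiation bop :: (complex_inner) "{ring, monoid_mult}"
begin

lift_definition one_bop :: "'a bop" is "\<lambda>x. x"
  by (simp add: clinear_iff)
lift_definition times_bop :: "'a bop \<Rightarrow> 'a bop \<Rightarrow> 'a bop" is "\<lambda>f g x. f (g x)"
  by (simp add: clinear_iff bounded_linear_compose)

instance
  by standard (transfer; simp add: fun_eq_iff clinear_iff)+

end

instantiation bop :: (complex_inner) real_normed_algebra
begin

lift_definition norm_bop :: "'a bop \<Rightarrow> real" is onorm .

definition dist_bop :: "'a bop \<Rightarrow> 'a bop \<Rightarrow> real"
  where "dist_bop S T = norm (S - T)"
definition [code del]: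
  "(uniformity :: ('a bop \<times> 'a bop) filter) = (INF e\<in>{0<..}. principal {(x, y). dist x y < e})"
definition open_bop :: "'a bop set \<Rightarrow> bool"
  where [code del]: "open_bop S \<longleftrightarrow> (\<forall>x\<in>S. \<forall>\<^sub>F (x', y) in uniformity. x' = x \<longrightarrow> y \<in> S)"
definition sgn_bop :: "'a bop \<Rightarrow> 'a bop"
  where "sgn_bop T = inverse (norm T) *\<^sub>R T"

instance
proof
  fix S T :: "'a bop" and a :: real
  show "norm (S + T) \<le> norm S + norm T"
    by transfer (simp add: onorm_triangle)
  show "norm T = 0 \<longleftrightarrow> T = 0"
    by transfer (auto simp: onorm_eq_0 fun_eq_iff)
  show "norm (a *\<^sub>R T) = \<bar>a\<bar> * norm T"
    by transfer (simp add: onorm_scaleR)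
  show "norm (S * T) \<le> norm S * norm T"
    by transfer (use onorm_compose in \<open>auto simp: comp_def\<close>)
  show "a *\<^sub>R S * T = a *\<^sub>R (S * T)"
    by transfer simp
  show "S * a *\<^sub>R T = a *\<^sub>R (S * T)"
    by transfer (simp add: clinear_iff scaleC_of_real[symmetric])
qed (auto simp: dist_bop_def sgn_bop_def uniformity_bop_def open_bop_def)

end

section \<open>The operator order\<close>

definition positive_bop :: "'a::complex_inner bop \<Rightarrow> bool"
  where "positive_bop T \<longleftrightarrow>
    (\<forall>x. cinner (bop_apply T x) x \<in> \<real> \<and> 0 \<le> Re (cinner (bop_apply T x) x))"

lemma bop_eq_0_if_cinner_eq_0:
  assumes 0: "\<And>x. cinner (bop_apply T x) x = 0"
  shows "T = (0 :: 'a::complex_inner bop)"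
proof (rule bop_eqI)
  fix x
  have *: "cinner (bop_apply T x) y = 0" for y
  proof -
    have a: "cinner (bop_apply T x) y + cinner (bop_apply T y) x = 0"
      using 0[of "x + y"] 0[of x] 0[of y]
      by (simp add: bop_apply_add cinner_add_left cinner_add_right add.commute)
    have "cinner (bop_apply T x) (\<i> *\<^sub>C y) + cinner (bop_apply T (\<i> *\<^sub>C y)) x = 0"
      using 0[of "x + \<i> *\<^sub>C y"] 0[of x] 0[of "\<i> *\<^sub>C y"]
      by (simp only: bop_apply_add cinner_add_left cinner_add_right) (simp add: add.commute)
    then have "\<i> * (cinner (bop_apply T y) x - cinner (bop_apply T x) y) = 0"
      by (simp add: bop_apply_scaleC cinner_scaleC_left cinner_scaleC_right algebra_simps)
    then show ?thesis
      using a by (simp add: add_eq_0_iff)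
  qed
  have "cinner (bop_apply T x) (bop_apply T x) = 0"
    by (rule *)
  then have "bop_apply T x = 0"
    by (simp add: cinner_self)
  then show "bop_apply T x = bop_apply 0 x"
    by (simp add: zero_bop.rep_eq)
qed

lemma positive_bop_0: "positive_bop 0"
proof -
  have "cinner (0::'a) x = 0" for x
    using cinner_scaleC_left[of 0 0 x] by simp
  then show ?thesis
    by (simp add: positive_bop_def zero_bop.rep_eq)
qed

lemma positive_bop_add: "positive_bop S \<Longrightarrow> positive_bop T \<Longrightarrow> positive_bop (S + T)"
  by (simp add: positive_bop_def plus_bop.rep_eq cinner_add_left)

lemma positive_bop_antisym:
  assumes "positive_bop T" "positive_bop (- T)"
  shows "T = 0"
proof (rule bop_eq_0_if_cinner_eq_0)
  fix x
  have "cinner (bop_apply (- T) x) x = - cinner (bop_apply T x) x"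
    using cinner_scaleC_left[of "-1" "bop_apply T x" x]
    by (simp add: uminus_bop.rep_eq complex_vector.scale_minus_left scaleC_one)
  then have "Re (cinner (bop_apply T x) x) = 0" "cinner (bop_apply T x) x \<in> \<real>"
    using assms by (auto simp: positive_bop_def intro: antisym) (metis antisym neg_0_le_iff_le uminus_complex.sel(1))
  then show "cinner (bop_apply T x) x = 0"
    by (simp add: complex_eq_iff complex_is_Real_iff)
qed

instantiation bop :: (complex_inner) order
begin

definition less_eq_bop :: "'a bop \<Rightarrow> 'a bop \<Rightarrow> bool"
  where "S \<le> T \<longleftrightarrow> positive_bop (T - S)"
definition less_bop :: "'a bop \<Rightarrow> 'a bop \<Rightarrow> bool"
  where "less_bop S T \<longleftrightarrow> S \<le> T \<and> \<not> T \<le> S"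

instance
proof
  fix R S T :: "'a bop"
  show "S < T \<longleftrightarrow> S \<le> T \<and> \<not> T \<le> S"
    by (rule less_bop_def)
  show "S \<le> S"
    by (simp add: less_eq_bop_def positive_bop_0)
  show "R \<le> T" if "R \<le> S" "S \<le> T"
    using positive_bop_add[OF that(2,1)[unfolded less_eq_bop_def]] by (simp add: less_eq_bop_def)
  show "S = T" if "S \<le> T" "T \<le> S"
    using positive_bop_antisym[of "T - S"] that by (simp add: less_eq_bop_def)
qed

end

instance bop :: (complex_inner) ordered_ab_group_add
  by standard (simp add: less_eq_bop_def)

lemma bop_nonneg_iff:
  "0 \<le> T \<longleftrightarrow> (\<forall>x. cinner (bop_apply T x) x \<in> \<real> \<and> 0 \<le> Re (cinner (bop_apply T x) x))"
  by (simp add: less_eq_bop_def positive_bop_def)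

definition positive_map :: "('a::complex_inner bop \<Rightarrow> 'b::complex_inner bop) \<Rightarrow> bool"
  where "positive_map \<Phi> \<longleftrightarrow> (\<forall>X. 0 \<le> X \<longrightarrow> 0 \<le> \<Phi> X)"

definition unital :: "('a::complex_inner bop \<Rightarrow> 'b::complex_inner bop) \<Rightarrow> bool"
  where "unital \<Phi> \<longleftrightarrow> \<Phi> 1 = 1"

section \<open>Inverses, spectrum and continuous functional calculus\<close>

definition bop_invertible :: "'a::complex_inner bop \<Rightarrow> bool"
  where "bop_invertible T \<longleftrightarrow> (\<exists>S. S * T = 1 \<and> T * S = 1)"

definition bop_inv :: "'a::complex_inner bop \<Rightarrow> 'a bop"
  where "bop_inv T = (THE S. S * T = 1 \<and> T * S = 1)"

lemma bop_inv_eqI: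
  assumes "S * T = 1" "T * S = 1"
  shows "bop_inv T = S"
  unfolding bop_inv_def
proof (rule the_equality)
  show "S' = S" if "S' * T = 1 \<and> T * S' = 1" for S'
    using assms that by (metis mult.assoc mult_1_left mult_1_right)
qed (use assms in simp)

definition spectrum :: "'a::complex_inner bop \<Rightarrow> complex set"
  where "spectrum T = {z. \<not> bop_invertible (T - z *\<^sub>C 1)}"

definition poly_bop :: "real poly \<Rightarrow> 'a::complex_inner bop \<Rightarrow> 'a bop"
  where "poly_bop p T = (\<Sum>i\<le>degree p. coeff p i *\<^sub>R T ^ i)"

text \<open>Continuous functional calculus for a self-adjoint operator \<open>T\<close> (whose spectrum is a compact
  set of reals) and a real function \<open>f\<close> that is continuous on the spectrum: \<open>f(T)\<close> is the limit in
  operator norm of \<open>p\<^sub>n(T)\<close> for any real polynomials \<open>p\<^sub>n\<close> converging to \<open>f\<close> uniformly on the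
  spectrum. For other \<open>T\<close> or \<open>f\<close> the value is unspecified.\<close>

definition fun_calc :: "(real \<Rightarrow> real) \<Rightarrow> 'a::complex_inner bop \<Rightarrow> 'a bop"
  where "fun_calc f T = (THE S. \<exists>p :: nat \<Rightarrow> real poly.
    uniform_limit {t. complex_of_real t \<in> spectrum T} (\<lambda>n. poly (p n)) f sequentially \<and>
    (\<lambda>n. poly_bop (p n) T) \<longlonglongrightarrow> S)"

text \<open>Only meant for positive invertible \<open>T\<close>, as \<open>0 powr s = 0\<close> even for \<open>s \<le> 0\<close>.\<close>

definition bop_powr :: "'a::complex_inner bop \<Rightarrow> real \<Rightarrow> 'a bop"
  where "bop_powr T s = fun_calc (\<lambda>t. t powr s) T"

section \<open>Operator means and the Kantorovich constant\<close>

definition amean :: "'a::complex_inner bop \<Rightarrow> real \<Rightarrow> 'a bop \<Rightarrow> 'a bop"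
    ("(_ \<nabla>\<^bsub>_\<^esub> _)" [71, 0, 71] 70)
  where "X \<nabla>\<^bsub>\<nu>\<^esub> Y = (1 - \<nu>) *\<^sub>R X + \<nu> *\<^sub>R Y"

definition gmean :: "'a::complex_inner bop \<Rightarrow> real \<Rightarrow> 'a bop \<Rightarrow> 'a bop"
    ("(_ \<sharp>\<^bsub>_\<^esub> _)" [71, 0, 71] 70)
  where "X \<sharp>\<^bsub>\<nu>\<^esub> Y =
    bop_powr X (1/2) * bop_powr (bop_powr X (-1/2) * Y * bop_powr X (-1/2)) \<nu> * bop_powr X (1/2)"

definition kantorovich :: "real \<Rightarrow> real"
  where "kantorovich t = (1 + t)\<^sup>2 / (4 * t)"

end

theory Submission
  imports Defs "HOL-Computational_Algebra.Fundamental_Theorem_Algebra"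
begin

text \<open>
  Write \<open>X\<close> for the operator \<open>A \<nabla>\<^bsub>\<nu>\<^esub> B + 2rMm(A\<^sup>-\<^sup>1 \<nabla> B\<^sup>-\<^sup>1 - A\<^sup>-\<^sup>1 \<sharp> B\<^sup>-\<^sup>1)\<close>, \<open>G\<close> for
  \<open>A \<sharp>\<^bsub>\<nu>\<^esub> B\<close> and \<open>k\<close> for \<open>K(\<surd>h')\<close> to the power \<open>r\<^sub>1\<close>. Both inequalities have the form
  \<open>\<Phi>(X)\<^sup>2 \<le> (K(h)/k)\<^sup>2 Z\<^sup>2\<close> with an operator \<open>Z \<ge> \<Phi>(G)\<close>: in the first one \<open>Z = \<Phi>(G)\<close>, in the second
  one \<open>Z = \<Phi>(A) \<sharp>\<^bsub>\<nu>\<^esub> \<Phi>(B)\<close>, which dominates \<open>\<Phi>(G)\<close> by Ando's inequality (\<open>map_gmean_le\<close>). So it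
  suffices to treat such a \<open>Z\<close> (\<open>square_map_le\<close>).

  The argument bounds a sum and deduces a bound on a product. Squaring does not preserve the operator
  order, but if \<open>S, T \<ge> 0\<close> and \<open>S + T \<le> l\<close>, then the norm of \<open>S T\<close> is at most \<open>l\<^sup>2/4\<close>, an
  arithmetic-geometric mean inequality of Bhatia and Kittaneh (\<open>square_compression_le\<close>). Take
  \<open>S = \<Phi>(X)\<close>, \<open>T = Mmk Z\<^sup>-\<^sup>1\<close> and \<open>l = M + m\<close>; the constant becomes
  \<open>(M + m)\<^sup>2/(4Mmk) = K(h)/k\<close>. The bound on the sum comes from three facts:
  \<^item> \<open>Z\<^sup>-\<^sup>1 \<le> \<Phi>(G\<^sup>-\<^sup>1)\<close>, Choi's inequality for the inverse (\<open>bop_inv_map_le\<close>);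
  \<^item> a refined Young inequality for \<open>A\<^sup>-\<^sup>1\<close> and \<open>B\<^sup>-\<^sup>1\<close> (\<open>refined_Young_bop\<close>), which gives
    \<open>X + Mmk G\<^sup>-\<^sup>1 \<le> (1 - \<nu>)(A + MmA\<^sup>-\<^sup>1) + \<nu>(B + MmB\<^sup>-\<^sup>1)\<close>; the gap between the spectra of \<open>A\<close> and
    \<open>B\<close> keeps the spectrum of \<open>A\<^sup>-\<^sup>1\<^sup>/\<^sup>2BA\<^sup>-\<^sup>1\<^sup>/\<^sup>2\<close> away from \<open>1\<close> and thereby produces \<open>k\<close>;
  \<^item> \<open>A + MmA\<^sup>-\<^sup>1 \<le> M + m\<close> for \<open>m \<le> A \<le> M\<close> (\<open>add_inverse_le\<close>), that is,
    \<open>(M - t)(t - m) \<ge> 0\<close>.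

  Two tools carry the rest. First, the top of the numerical range of a self-adjoint operator is an
  approximate eigenvalue (\<open>approximate_eigenvalue_above\<close>). Together with
  the factorization of polynomials it yields \<open>p(T) \<ge> 0\<close> for polynomials \<open>p\<close> that are nonnegative on the
  spectrum, on which the functional calculus rests, and it replaces eigenvectors in the proof of the
  Bhatia-Kittaneh inequality and of Ando's inequality. Second, the Bernstein polynomials of an
  interval that contains the spectrum turn into positive operators that sum to \<open>1\<close>; they play the part of a
  spectral measure, so that a positive map satisfies a Schwarz inequality on the functions of one
  operator (\<open>calc_Schwarz\<close>). Choi's inequality is an instance, and concavity of \<open>t\<^sup>s\<close> under a
  unital positive map (\<open>map_powr_le\<close>) follows from it by bisecting the interval of exponents.
\<close>

section \<open>Quadratic forms of operators\<close>

notation bop_apply (infixr "\<cdot>" 75)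

text \<open>The real part of the inner product makes the space a real Hilbert space with the same norm. A
  complex-linear operator is self-adjoint for \<open>cinner\<close> iff it is symmetric for \<open>rin\<close>, since \<open>cinner\<close> can be
  recovered from \<open>rin\<close> by multiplying an argument by \<open>\<i>\<close>. All estimates below are therefore real.\<close>

definition rin :: "'a::complex_inner \<Rightarrow> 'a \<Rightarrow> real"
  where "rin x y = Re (cinner x y)"

lemma rin_commute: "rin x y = rin y x"
  unfolding rin_def by (subst cinner_commute) simp

lemma rin_add_left: "rin (x + y) z = rin x z + rin y z"
  by (simp add: rin_def cinner_add_left)

lemma rin_scaleR_left: "rin (c *\<^sub>R x) y = c * rin x y"
  by (simp add: rin_def scaleC_of_real[symmetric] cinner_scaleC_left)

lemma rin_self: "rin x x = (norm x)\<^sup>2"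
  by (simp add: rin_def cinner_self)

lemma rin_scaleC_i_right: "rin x (\<i> *\<^sub>C y) = Im (cinner x y)"
  by (simp add: rin_def cinner_scaleC_right)

lemma rin_add_right: "rin z (x + y) = rin z x + rin z y"
  by (metis rin_commute rin_add_left)

lemma rin_scaleR_right: "rin y (c *\<^sub>R x) = c * rin y x"
  by (metis rin_commute rin_scaleR_left)

lemma rin_Cauchy_Schwarz: "\<bar>rin x y\<bar> \<le> norm x * norm y"
proof (cases "y = 0")
  case True
  have "rin x (0 *\<^sub>R y) = 0 * rin x y" by (rule rin_scaleR_right)
  then show ?thesis using True by simp
next
  case False
  define t where "t = - rin x y / (norm y)\<^sup>2"
  have ny: "(norm y)\<^sup>2 > 0" using False by simp
  have "0 \<le> rin (x + t *\<^sub>R y) (x + t *\<^sub>R y)" by (simp add: rin_self)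
  also have "\<dots> = (norm x)\<^sup>2 + 2 * t * rin x y + t\<^sup>2 * (norm y)\<^sup>2"
    unfolding rin_self[symmetric]
    by (simp add: rin_add_left rin_add_right rin_scaleR_left rin_scaleR_right rin_commute[of y x]
        power2_eq_square algebra_simps)
  also have "\<dots> = (norm x)\<^sup>2 - (rin x y)\<^sup>2 / (norm y)\<^sup>2"
    using ny by (simp add: t_def field_simps power2_eq_square)
  finally have "(rin x y)\<^sup>2 \<le> (norm x * norm y)\<^sup>2"
    using ny by (simp add: field_simps)
  then show ?thesis
    using abs_le_square_iff[of "rin x y" "norm x * norm y"] by simp
qed

interpretation rin: bounded_bilinear rin
proof
  show "\<exists>K. \<forall>a b. norm (rin a b) \<le> norm a * norm b * K"
    by (rule exI[of _ 1]) (simp add: rin_Cauchy_Schwarz)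
qed (simp_all add: rin_add_left rin_add_right rin_scaleR_left rin_scaleR_right)

lemma rin_le: "rin x y \<le> norm x * norm y"
  using rin_Cauchy_Schwarz[of x y] by linarith

lemma bop_times [simp]: "(S * T) \<cdot> x = S \<cdot> T \<cdot> x"
  by (simp add: times_bop.rep_eq)
lemma bop_one [simp]: "1 \<cdot> x = x"
  by (simp add: one_bop.rep_eq)
lemma bop_zero [simp]: "0 \<cdot> x = 0"
  by (simp add: zero_bop.rep_eq)
lemma bop_plus [simp]: "(S + T) \<cdot> x = S \<cdot> x + T \<cdot> x"
  by (simp add: plus_bop.rep_eq)
lemma bop_diff [simp]: "(S - T) \<cdot> x = S \<cdot> x - T \<cdot> x"
  by (simp add: minus_bop.rep_eq)
lemma bop_uminus [simp]: "(- T) \<cdot> x = - (T \<cdot> x)"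
  by (simp add: uminus_bop.rep_eq)
lemma bop_scaleR [simp]: "(c *\<^sub>R T) \<cdot> x = c *\<^sub>R (T \<cdot> x)"
  by (simp add: scaleR_bop.rep_eq)
lemma bop_scaleC [simp]: "(c *\<^sub>C T) \<cdot> x = c *\<^sub>C (T \<cdot> x)"
  by (simp add: scaleC_bop.rep_eq)

lemma bop_sum: "(\<Sum>i\<in>I. T i) \<cdot> x = (\<Sum>i\<in>I. T i \<cdot> x)"
  by (induction I rule: infinite_finite_induct) auto

lemmas bop_linear = bounded_linear_bop_apply[THEN bounded_linear.linear]
lemmas bop_apply_diff = linear_diff[OF bop_linear]
  and bop_apply_zero = linear_0[OF bop_linear]
  and bop_apply_minus = linear_neg[OF bop_linear]
  and bop_apply_scaleR = linear_scale[OF bop_linear]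

lemma norm_bop_apply: "norm (T \<cdot> x) \<le> norm T * norm x"
  unfolding norm_bop.rep_eq by (rule onorm[OF bounded_linear_bop_apply])

lemma norm_bop_leI: "0 \<le> e \<Longrightarrow> (\<And>x. norm (T \<cdot> x) \<le> e * norm x) \<Longrightarrow> norm T \<le> e"
  unfolding norm_bop.rep_eq by (rule onorm_bound)

definition selfadjoint :: "'a::complex_inner bop \<Rightarrow> bool"
  where "selfadjoint T \<longleftrightarrow> (\<forall>x y. rin (T \<cdot> x) y = rin x (T \<cdot> y))"

lemma selfadjointD: "selfadjoint T \<Longrightarrow> rin (T \<cdot> x) y = rin x (T \<cdot> y)"
  by (simp add: selfadjoint_def)

lemma selfadjoint_zero [simp, intro]: "selfadjoint 0"
  by (simp add: selfadjoint_def rin.zero_left rin.zero_right)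
lemma selfadjoint_one [simp, intro]: "selfadjoint 1"
  by (simp add: selfadjoint_def)
lemma selfadjoint_add [simp, intro]: "selfadjoint S \<Longrightarrow> selfadjoint T \<Longrightarrow> selfadjoint (S + T)"
  by (simp add: selfadjoint_def rin.add_left rin.add_right)
lemma selfadjoint_diff [simp, intro]: "selfadjoint S \<Longrightarrow> selfadjoint T \<Longrightarrow> selfadjoint (S - T)"
  by (simp add: selfadjoint_def rin.diff_left rin.diff_right)
lemma selfadjoint_uminus [simp, intro]: "selfadjoint S \<Longrightarrow> selfadjoint (- S)"
  by (simp add: selfadjoint_def rin.minus_left rin.minus_right)
lemma selfadjoint_scaleR [simp, intro]: "selfadjoint S \<Longrightarrow> selfadjoint (c *\<^sub>R S)"
  by (simp add: selfadjoint_def rin.scaleR_left rin.scaleR_right)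
lemma selfadjoint_sandwich [simp, intro]: "selfadjoint C \<Longrightarrow> selfadjoint S \<Longrightarrow> selfadjoint (C * S * C)"
  by (simp add: selfadjoint_def)
lemma selfadjoint_mult_commute: "selfadjoint S \<Longrightarrow> selfadjoint T \<Longrightarrow> S * T = T * S \<Longrightarrow> selfadjoint (S * T)"
  by (metis selfadjoint_def bop_times)
lemma selfadjoint_square [simp, intro]: "selfadjoint S \<Longrightarrow> selfadjoint (S * S)"
  by (rule selfadjoint_mult_commute) auto
lemma selfadjoint_power [simp, intro]: "selfadjoint S \<Longrightarrow> selfadjoint (S ^ n)"
  by (induction n) (auto intro!: selfadjoint_mult_commute simp: power_commutes)
lemma selfadjoint_sum [intro]: "(\<And>i. i \<in> I \<Longrightarrow> selfadjoint (T i)) \<Longrightarrow> selfadjoint (\<Sum>i\<in>I. T i)"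
  by (induction I rule: infinite_finite_induct) auto

text \<open>A form that takes only real values comes from a self-adjoint operator, because in a complex space
  the imaginary parts at \<open>x + \<i> y\<close> compare \<open>rin (T x) y\<close> with \<open>rin (T y) x\<close>.\<close>

lemma bop_nonneg_iff_rin: "0 \<le> T \<longleftrightarrow> selfadjoint T \<and> (\<forall>x. 0 \<le> rin (T \<cdot> x) x)"
proof
  assume *: "0 \<le> T"
  have im: "Im (cinner (T \<cdot> x) x) = 0" for x
    using * by (simp add: bop_nonneg_iff complex_is_Real_iff)
  have "rin (T \<cdot> x) y = rin x (T \<cdot> y)" for x y
  proof -
    have "Im (cinner (T \<cdot> (x + \<i> *\<^sub>C y)) (x + \<i> *\<^sub>C y)) = rin (T \<cdot> y) x - rin (T \<cdot> x) y"
      using im[of x] im[of "\<i> *\<^sub>C y"]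
      by (simp add: bop_apply_add bop_apply_scaleC cinner_add_left cinner_add_right
          cinner_scaleC_left cinner_scaleC_right rin_def)
    then show ?thesis using im[of "x + \<i> *\<^sub>C y"] rin_commute[of x "T \<cdot> y"] by simp
  qed
  then show "selfadjoint T \<and> (\<forall>x. 0 \<le> rin (T \<cdot> x) x)"
    using * by (simp add: selfadjoint_def bop_nonneg_iff rin_def)
next
  assume *: "selfadjoint T \<and> (\<forall>x. 0 \<le> rin (T \<cdot> x) x)"
  have "Im (cinner (T \<cdot> x) x) = 0" for x
  proof -
    have "Im (cinner (T \<cdot> x) x) = Im (cinner x (T \<cdot> x))"
      using * unfolding rin_scaleC_i_right[symmetric] by (simp add: selfadjointD bop_apply_scaleC)
    moreover have "Im (cinner x (T \<cdot> x)) = - Im (cinner (T \<cdot> x) x)"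
      by (subst cinner_commute) simp
    ultimately show ?thesis by simp
  qed
  then show "0 \<le> T"
    using * by (simp add: bop_nonneg_iff rin_def complex_is_Real_iff)
qed

lemma bop_le_iff_rin: "S \<le> T \<longleftrightarrow> selfadjoint (T - S) \<and> (\<forall>x. 0 \<le> rin ((T - S) \<cdot> x) x)"
  using bop_nonneg_iff_rin[of "T - S"] by simp

lemma selfadjoint_nonneg: "0 \<le> T \<Longrightarrow> selfadjoint T"
  by (simp add: bop_nonneg_iff_rin)

lemma bop_leI: "selfadjoint S \<Longrightarrow> selfadjoint T \<Longrightarrow> (\<And>x. rin (S \<cdot> x) x \<le> rin (T \<cdot> x) x) \<Longrightarrow> S \<le> T"
  using bop_nonneg_iff_rin[of "T - S"] by (simp add: rin.diff_left)

lemma bop_leD: "S \<le> T \<Longrightarrow> rin (S \<cdot> x) x \<le> rin (T \<cdot> x) x"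
  using bop_nonneg_iff_rin[of "T - S"] by (simp add: rin.diff_left)

lemma bop_nonnegD: "0 \<le> T \<Longrightarrow> 0 \<le> rin (T \<cdot> x) x"
  by (simp add: bop_nonneg_iff_rin)

lemma selfadjoint_le_right: "S \<le> T \<Longrightarrow> selfadjoint S \<Longrightarrow> selfadjoint T"
  using selfadjoint_nonneg[of "T - S"] selfadjoint_add[of "T - S" S] by simp

instance bop :: (complex_inner) ordered_real_vector
proof
  fix S T :: "'a bop" and a b :: real
  show "a *\<^sub>R S \<le> a *\<^sub>R T" if "S \<le> T" "0 \<le> a"
  proof -
    have "0 \<le> a *\<^sub>R (T - S)"
      using that bop_le_iff_rin[of S T]
      by (simp add: bop_nonneg_iff_rin rin.scaleR_left del: bop_diff)
    then show ?thesis by (simp add: scaleR_diff_right)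
  qed
  show "a *\<^sub>R T \<le> b *\<^sub>R T" if "a \<le> b" "0 \<le> T"
  proof -
    have "0 \<le> (b - a) *\<^sub>R T"
      using that by (simp add: bop_nonneg_iff_rin rin.scaleR_left)
    then show ?thesis by (simp add: scaleR_diff_left)
  qed
qed

lemma rin_sandwich: "selfadjoint C \<Longrightarrow> rin ((C * S * C) \<cdot> x) x = rin (S \<cdot> C \<cdot> x) (C \<cdot> x)"
  by (simp add: selfadjointD)

lemma sandwich_mono:
  assumes "selfadjoint C" "S \<le> T"
  shows "C * S * C \<le> C * T * C"
proof -
  have "0 \<le> C * (T - S) * C"
    using assms bop_le_iff_rin[of S T]
    by (auto simp: bop_nonneg_iff_rin rin_sandwich simp del: bop_diff bop_times)
  then show ?thesis by (simp add: algebra_simps)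
qed

lemma polarization:
  assumes "selfadjoint S"
  shows "4 * rin (S \<cdot> x) y = rin (S \<cdot> (x + y)) (x + y) - rin (S \<cdot> (x - y)) (x - y)"
  using selfadjointD[OF assms, of x y] rin_commute[of x "S \<cdot> y"]
  by (simp add: bop_apply_add bop_apply_diff rin.add_left rin.add_right rin.diff_left rin.diff_right)

lemma parallelogram: "(norm (x + y))\<^sup>2 + (norm (x - y))\<^sup>2 = 2 * (norm x)\<^sup>2 + 2 * (norm (y::'a::complex_inner))\<^sup>2"
  by (simp add: rin_self[symmetric] rin.add_left rin.add_right rin.diff_left rin.diff_right)

text \<open>For self-adjoint operators the norm is controlled by the quadratic form: polarize and
  test with the multiple of \<open>S x\<close> that has the same length as \<open>x\<close>.\<close>

lemma norm_le_if_form_le: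
  assumes "selfadjoint S" "0 \<le> e" and le: "\<And>x. \<bar>rin (S \<cdot> x) x\<bar> \<le> e * (norm x)\<^sup>2"
  shows "norm S \<le> e"
proof (rule norm_bop_leI)
  fix x
  show "norm (S \<cdot> x) \<le> e * norm x"
  proof (cases "S \<cdot> x = 0")
    case True
    then show ?thesis using assms by simp
  next
    case False
    define y where "y = (norm x / norm (S \<cdot> x)) *\<^sub>R (S \<cdot> x)"
    have ny: "norm y = norm x" using False by (simp add: y_def)
    have "4 * (norm x * norm (S \<cdot> x)) = 4 * rin (S \<cdot> x) y"
      using False by (simp add: y_def rin.scaleR_right rin_self power2_eq_square)
    also have "\<dots> \<le> e * (norm (x + y))\<^sup>2 + e * (norm (x - y))\<^sup>2"
      using le[of "x + y"] le[of "x - y"] unfolding polarization[OF \<open>selfadjoint S\<close>] by linarith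
    also have "\<dots> = 4 * (e * (norm x * norm x))"
      unfolding distrib_left[symmetric] parallelogram ny by (simp add: power2_eq_square)
    finally have "norm x * norm (S \<cdot> x) \<le> norm x * (e * norm x)"
      by (simp add: ac_simps)
    moreover have "norm x > 0" using False bop_apply_zero by fastforce
    ultimately show ?thesis by simp
  qed
qed (rule assms)

lemma norm_le_iff:
  assumes "selfadjoint S" "0 \<le> e"
  shows "norm S \<le> e \<longleftrightarrow> - (e *\<^sub>R 1) \<le> S \<and> S \<le> e *\<^sub>R 1"
proof
  assume n: "norm S \<le> e"
  have "\<bar>rin (S \<cdot> x) x\<bar> \<le> e * rin x x" for x
  proof -
    have "\<bar>rin (S \<cdot> x) x\<bar> \<le> norm (S \<cdot> x) * norm x" by (rule rin_Cauchy_Schwarz)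
    also have "\<dots> \<le> (e * norm x) * norm x"
      using norm_bop_apply[of S x] n by (meson mult_right_mono norm_ge_zero order_trans)
    finally show ?thesis by (simp add: rin_self power2_eq_square)
  qed
  note * = abs_le_D1[OF this] abs_le_D2[OF this]
  show "- (e *\<^sub>R 1) \<le> S \<and> S \<le> e *\<^sub>R 1"
    using * assms by (auto intro!: bop_leI simp: rin.scaleR_left rin.minus_left minus_le_iff)
next
  assume *: "- (e *\<^sub>R 1) \<le> S \<and> S \<le> e *\<^sub>R 1"
  have "\<bar>rin (S \<cdot> x) x\<bar> \<le> e * (norm x)\<^sup>2" for x
    using bop_leD[of "- (e *\<^sub>R 1)" S x] bop_leD[of S "e *\<^sub>R 1" x] *
    by (simp add: rin.scaleR_left rin.minus_left rin_self abs_le_iff)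
  then show "norm S \<le> e" using norm_le_if_form_le assms by blast
qed

lemma selfadjoint_le_norm: "selfadjoint S \<Longrightarrow> S \<le> norm S *\<^sub>R 1"
  using norm_le_iff[of S "norm S"] by simp

lemma tendsto_bop_apply: "(T \<longlongrightarrow> S) F \<Longrightarrow> ((\<lambda>n. T n \<cdot> x) \<longlongrightarrow> S \<cdot> x) F"
proof -
  have "bounded_linear (\<lambda>T. T \<cdot> x)"
    by (rule bounded_linear_intro[where K = "norm x"])
      (simp_all add: norm_bop_apply)
  then show "(T \<longlongrightarrow> S) F \<Longrightarrow> ((\<lambda>n. T n \<cdot> x) \<longlongrightarrow> S \<cdot> x) F"
    by (rule bounded_linear.tendsto)
qed

lemma tendsto_rin_bop: "(T \<longlongrightarrow> S) F \<Longrightarrow> ((\<lambda>n. rin (T n \<cdot> x) y) \<longlongrightarrow> rin (S \<cdot> x) y) F"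
  by (intro rin.tendsto tendsto_bop_apply tendsto_const)

lemma selfadjoint_limit:
  assumes "T \<longlonglongrightarrow> S" "\<And>n. selfadjoint (T n)"
  shows "selfadjoint (S :: 'a::complex_inner bop)"
  unfolding selfadjoint_def
proof (intro allI)
  fix x y
  have "(\<lambda>n. rin (T n \<cdot> x) y) \<longlonglongrightarrow> rin (S \<cdot> x) y"
    by (rule tendsto_rin_bop[OF assms(1)])
  moreover have "(\<lambda>n. rin (T n \<cdot> x) y) \<longlonglongrightarrow> rin x (S \<cdot> y)"
    using tendsto_rin_bop[OF assms(1), of y x] assms(2) by (simp add: selfadjointD rin_commute[of _ x])
  ultimately show "rin (S \<cdot> x) y = rin x (S \<cdot> y)"
    by (rule LIMSEQ_unique)
qed

lemma nonneg_limit: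
  assumes "T \<longlonglongrightarrow> S" "\<And>n. 0 \<le> T n"
  shows "0 \<le> (S :: 'a::complex_inner bop)"
proof -
  have "selfadjoint S" using assms selfadjoint_limit selfadjoint_nonneg by blast
  moreover have "0 \<le> rin (S \<cdot> x) x" for x
    by (rule LIMSEQ_le_const[OF tendsto_rin_bop[OF assms(1)]]) (use assms(2) bop_nonnegD in blast)
  ultimately show ?thesis by (simp add: bop_nonneg_iff_rin)
qed

lemma le_limit:
  assumes "T \<longlonglongrightarrow> S" "T' \<longlonglongrightarrow> S'" "\<And>n. T n \<le> T' n"
  shows "S \<le> (S'::'a::complex_inner bop)"
  using nonneg_limit[OF tendsto_diff[OF assms(2,1)]] assms(3) by simp

section \<open>Completeness of the operator algebra\<close>

instance chilbert_space \<subseteq> banach ..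

text \<open>A sequence that is Cauchy in operator norm converges pointwise; the estimates are uniform in \<open>x\<close>
  after division by the norm of \<open>x\<close>, so the pointwise limit is bounded and is the limit in norm.\<close>

instance bop :: (chilbert_space) banach
proof
  fix T :: "nat \<Rightarrow> 'a bop"
  assume T: "Cauchy T"
  have C: "\<exists>N. \<forall>m\<ge>N. \<forall>n\<ge>N. \<forall>x. norm (T m \<cdot> x - T n \<cdot> x) \<le> e * norm x" if "e > 0" for e
  proof -
    from CauchyD[OF T \<open>e > 0\<close>] obtain N where N: "\<forall>m\<ge>N. \<forall>n\<ge>N. norm (T m - T n) < e" ..
    have "norm (T m \<cdot> x - T n \<cdot> x) \<le> e * norm x" if "m \<ge> N" "n \<ge> N" for m n x
    proof -
      have "norm (T m \<cdot> x - T n \<cdot> x) \<le> norm (T m - T n) * norm x"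
        using norm_bop_apply[of "T m - T n" x] by simp
      also have "\<dots> \<le> e * norm x"
        using N that by (intro mult_right_mono) (auto intro: less_imp_le)
      finally show ?thesis .
    qed
    then show ?thesis by blast
  qed
  have "Cauchy (\<lambda>n. T n \<cdot> x)" for x
  proof (rule CauchyI)
    fix e :: real assume "e > 0"
    have pos: "norm x + 1 > 0" by (simp add: add_nonneg_pos)
    with \<open>e > 0\<close> have "e / (norm x + 1) > 0" by simp
    from C[OF this] obtain N where
      N: "\<forall>m\<ge>N. \<forall>n\<ge>N. \<forall>x'. norm (T m \<cdot> x' - T n \<cdot> x') \<le> e / (norm x + 1) * norm x'" by blast
    have "e / (norm x + 1) * norm x < e"
      using \<open>e > 0\<close> pos by (simp add: pos_divide_less_eq)
    then show "\<exists>N. \<forall>m\<ge>N. \<forall>n\<ge>N. norm (T m \<cdot> x - T n \<cdot> x) < e"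
      using N by (meson le_less_trans)
  qed
  then obtain L where L: "\<And>x. (\<lambda>n. T n \<cdot> x) \<longlonglongrightarrow> L x"
    unfolding Cauchy_convergent_iff convergent_def by metis
  have addL: "L (x + y) = L x + L y" for x y
    using LIMSEQ_unique[OF L[of "x + y"]] tendsto_add[OF L[of x] L[of y]]
    by (simp add: bop_apply_add)
  have scL: "L (c *\<^sub>C x) = c *\<^sub>C L x" for c x
    using LIMSEQ_unique[OF L[of "c *\<^sub>C x"]]
      bounded_linear.tendsto[OF bounded_linear_scaleC L, of c x]
    by (simp add: bop_apply_scaleC)
  have lim: "\<exists>N. \<forall>n\<ge>N. \<forall>x. norm (T n \<cdot> x - L x) \<le> e * norm x" if e: "e > 0" for e
  proof -
    obtain N where N: "\<forall>m\<ge>N. \<forall>n\<ge>N. \<forall>x. norm (T m \<cdot> x - T n \<cdot> x) \<le> e * norm x"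
      using C[OF e] by blast
    have "norm (T n \<cdot> x - L x) \<le> e * norm x" if "n \<ge> N" for n x
    proof (rule LIMSEQ_le_const2)
      show "(\<lambda>m. norm (T n \<cdot> x - T m \<cdot> x)) \<longlonglongrightarrow> norm (T n \<cdot> x - L x)"
        by (intro tendsto_intros L)
    qed (use N that in blast)
    then show ?thesis by blast
  qed
  obtain N where N: "\<And>x. norm (T N \<cdot> x - L x) \<le> norm x"
    using lim[of 1] by auto
  have "norm (L x) \<le> norm x * (norm (T N) + 1)" for x
  proof -
    have "norm (L x) \<le> norm (T N \<cdot> x) + norm (T N \<cdot> x - L x)"
      by (metis norm_minus_commute norm_triangle_sub)
    also have "\<dots> \<le> norm (T N) * norm x + norm x"
      using norm_bop_apply N by (meson add_mono)
    finally show ?thesis by (simp add: algebra_simps)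
  qed
  then have "bounded_linear L"
    by (intro bounded_linear_intro[where K = "norm (T N) + 1"])
      (simp_all add: addL scL scaleC_of_real[symmetric])
  moreover have "clinear L"
    by (simp add: clinear_iff addL scL)
  ultimately have ap: "bop_apply (Abs_bop L) = L"
    by (simp add: Abs_bop_inverse)
  have "T \<longlonglongrightarrow> Abs_bop L"
  proof (rule LIMSEQ_I)
    fix e :: real assume "e > 0"
    then obtain N where N: "\<forall>n\<ge>N. \<forall>x. norm (T n \<cdot> x - L x) \<le> e / 2 * norm x"
      using lim[of "e / 2"] by auto
    have "norm (T n - Abs_bop L) \<le> e / 2" if "n \<ge> N" for n
      by (rule norm_bop_leI) (use that N \<open>e > 0\<close> in \<open>auto simp: ap\<close>)
    moreover have "e / 2 < e" using \<open>e > 0\<close> by simp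
    ultimately show "\<exists>N. \<forall>n\<ge>N. norm (T n - Abs_bop L) < e"
      by (meson le_less_trans)
  qed
  then show "convergent T" by (rule convergentI)
qed

section \<open>Polynomials of a self-adjoint operator\<close>

definition bounded_below :: "'a::complex_inner bop \<Rightarrow> bool"
  where "bounded_below T \<longleftrightarrow> (\<exists>c>0. \<forall>x. c * norm x \<le> norm (T \<cdot> x))"

lemma bounded_belowI: "c > 0 \<Longrightarrow> (\<And>x. c * norm x \<le> norm (T \<cdot> x)) \<Longrightarrow> bounded_below T"
  unfolding bounded_below_def by blast

lemma bounded_below_mult:
  assumes "bounded_below S" "bounded_below T"
  shows "bounded_below (S * T)"
proof -
  obtain c d where cd: "c > 0" "d > 0" "\<And>x. c * norm x \<le> norm (S \<cdot> x)" "\<And>x. d * norm x \<le> norm (T \<cdot> x)"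
    using assms unfolding bounded_below_def by blast
  have "c * d * norm x \<le> norm ((S * T) \<cdot> x)" for x
  proof -
    have "c * (d * norm x) \<le> c * norm (T \<cdot> x)"
      using cd(1,4) by (intro mult_left_mono) auto
    then show ?thesis using cd(3)[of "T \<cdot> x"] by simp
  qed
  then show ?thesis using cd by (intro bounded_belowI[of "c * d"]) auto
qed

lemma bounded_below_uminus [simp]: "bounded_below (- T) \<longleftrightarrow> bounded_below T"
  by (simp add: bounded_below_def)

lemma bounded_below_left_inverse:
  assumes "S * T = 1"
  shows "bounded_below T"
proof (rule bounded_belowI)
  have pos: "norm S + 1 > 0" by (simp add: add_nonneg_pos)
  then show "1 / (norm S + 1) > 0" by simp
  show "1 / (norm S + 1) * norm x \<le> norm (T \<cdot> x)" for x
  proof -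
    have "norm x = norm (S \<cdot> T \<cdot> x)" using assms by (metis bop_one bop_times)
    also have "\<dots> \<le> norm S * norm (T \<cdot> x)" by (rule norm_bop_apply)
    also have "\<dots> \<le> (norm S + 1) * norm (T \<cdot> x)" by (simp add: mult_right_mono)
    finally show ?thesis using pos by (simp add: pos_divide_le_eq mult.commute)
  qed
qed

text \<open>The numbers \<open>t\<close> for which \<open>T - t\<close> is not bounded below form the approximate point spectrum. It
  is contained in the spectrum, and for self-adjoint \<open>T\<close> it already decides the sign of a polynomial
  of \<open>T\<close>; working with it postpones all questions of surjectivity.\<close>

lemma not_bounded_below_spectrum:
  "\<not> bounded_below (T - t *\<^sub>R 1) \<Longrightarrow> complex_of_real t \<in> spectrum T"
  using bounded_below_left_inverse unfolding spectrum_def bop_invertible_def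
  by (auto simp: scaleC_of_real)

lemma approx_kernel:
  assumes "\<not> bounded_below T" "e > 0"
  obtains x where "norm x = 1" "norm (T \<cdot> x) < e"
proof -
  obtain x where x: "norm (T \<cdot> x) < e * norm x"
    using assms unfolding bounded_below_def by (meson not_le)
  then have "norm x > 0" using assms(2) by (metis bop_apply_zero less_irrefl mult_zero_right norm_zero zero_less_norm_iff)
  then have "norm ((1 / norm x) *\<^sub>R x) = 1" "norm (T \<cdot> ((1 / norm x) *\<^sub>R x)) < e"
    using x by (simp_all add: bop_apply_scaleR field_simps)
  then show ?thesis using that by blast
qed

lemma bounded_below_if_ge:
  assumes "d > 0" "d *\<^sub>R 1 \<le> P"
  shows "d * norm x \<le> norm (P \<cdot> x)"
proof -
  have "d * norm x * norm x \<le> norm (P \<cdot> x) * norm x"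
    using bop_leD[OF assms(2), of x] rin_le[of "P \<cdot> x" x]
    by (simp add: rin.scaleR_left rin_self power2_eq_square)
  then show ?thesis by (cases "norm x = 0") auto
qed

text \<open>The Cauchy-Schwarz inequality for the positive form of \<open>P\<close>, applied to \<open>x\<close> and \<open>P x\<close>. Adding \<open>1\<close>
  to the norm avoids a case distinction for \<open>P = 0\<close>.\<close>

lemma norm_square_le_form:
  assumes "0 \<le> P"
  shows "(norm (P \<cdot> x))\<^sup>2 \<le> (norm P + 1) * rin (P \<cdot> x) x"
proof -
  define C where "C = norm P + 1"
  have C: "C > 0" unfolding C_def by (simp add: add_nonneg_pos)
  define t where "t = - 1 / C"
  define y where "y = P \<cdot> x"
  have s: "selfadjoint P" using assms by (rule selfadjoint_nonneg)
  have "rin (P \<cdot> y) y \<le> norm P * (norm y)\<^sup>2"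
    using rin_le[of "P \<cdot> y" y] mult_right_mono[OF norm_bop_apply[of P y], of "norm y"]
    by (simp add: power2_eq_square)
  also have "\<dots> \<le> C * (norm y)\<^sup>2"
    by (simp add: C_def mult_right_mono)
  finally have 1: "rin (P \<cdot> y) y \<le> C * (norm y)\<^sup>2" .
  have "0 \<le> rin (P \<cdot> (x + t *\<^sub>R y)) (x + t *\<^sub>R y)"
    by (rule bop_nonnegD[OF assms])
  also have "\<dots> = rin (P \<cdot> x) x + 2 * t * (norm y)\<^sup>2 + t\<^sup>2 * rin (P \<cdot> y) y"
    using selfadjointD[OF s, of y x]
    by (simp add: bop_apply_add bop_apply_scaleR rin.add_left rin.add_right rin.scaleR_left
        rin.scaleR_right rin_self y_def[symmetric] power2_eq_square[of t] algebra_simps)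
  also have "\<dots> \<le> rin (P \<cdot> x) x + 2 * t * (norm y)\<^sup>2 + t\<^sup>2 * (C * (norm y)\<^sup>2)"
    using 1 by (intro add_left_mono mult_left_mono) auto
  also have "\<dots> = rin (P \<cdot> x) x - (norm y)\<^sup>2 / C"
    using C by (simp add: t_def field_simps power2_eq_square)
  finally show ?thesis
    unfolding C_def[symmetric] y_def[symmetric] using C by (simp add: pos_divide_le_eq mult.commute)
qed

text \<open>For positive operators, being bounded below as a map and as a form are equivalent.\<close>

lemma ge_if_bounded_below:
  assumes "0 \<le> P" "bounded_below P"
  obtains d where "d > 0" "d *\<^sub>R 1 \<le> P"
proof -
  obtain c where c: "c > 0" "\<And>x. c * norm x \<le> norm (P \<cdot> x)"
    using assms unfolding bounded_below_def by blast
  define C where "C = norm P + 1"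
  have C: "C > 0" unfolding C_def by (simp add: add_nonneg_pos)
  have "(c\<^sup>2 / C) * (norm x)\<^sup>2 \<le> rin (P \<cdot> x) x" for x
  proof -
    have "c\<^sup>2 * (norm x)\<^sup>2 \<le> (norm (P \<cdot> x))\<^sup>2"
      using power_mono[OF c(2)[of x], of 2] c(1) by (simp add: power_mult_distrib)
    also have "\<dots> \<le> C * rin (P \<cdot> x) x"
      unfolding C_def by (rule norm_square_le_form[OF assms(1)])
    finally show ?thesis using C by (simp add: field_simps)
  qed
  then have "(c\<^sup>2 / C) *\<^sub>R 1 \<le> P"
    using selfadjoint_nonneg[OF assms(1)] by (intro bop_leI) (auto simp: rin.scaleR_left rin_self)
  moreover have "c\<^sup>2 / C > 0" using c C by simp
  ultimately show ?thesis using that by blast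
qed

text \<open>The witness is the top \<open>\<beta>\<close> of the numerical range. If \<open>\<beta> - Y \<ge> 0\<close> were bounded below, then
  \<open>\<beta> - Y \<ge> d\<close> for some \<open>d > 0\<close>, and \<open>\<beta>\<close> would not be the least upper bound.\<close>

lemma approximate_eigenvalue_above:
  assumes "selfadjoint Y" "\<not> Y \<le> g *\<^sub>R 1"
  obtains \<beta> where "\<beta> > g" "\<not> bounded_below (Y - \<beta> *\<^sub>R 1)"
proof -
  define S where "S = {c. Y \<le> c *\<^sub>R 1}"
  have Sg: "g < c" if "c \<in> S" for c
  proof (rule ccontr)
    assume "\<not> g < c"
    then have "c *\<^sub>R 1 \<le> g *\<^sub>R (1::'a bop)"
      by (intro bop_leI) (auto simp: rin.scaleR_left rin_self mult_right_mono)
    then show False using that assms(2) unfolding S_def by (metis mem_Collect_eq order_trans)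
  qed
  have ne: "norm Y \<in> S" using selfadjoint_le_norm[OF assms(1)] by (simp add: S_def)
  have bdd: "bdd_below S" using Sg by (meson bdd_belowI less_imp_le)
  define \<beta> where "\<beta> = Inf S"
  have Yb: "Y \<le> \<beta> *\<^sub>R 1"
  proof (rule bop_leI)
    fix x
    show "rin (Y \<cdot> x) x \<le> rin ((\<beta> *\<^sub>R 1) \<cdot> x) x"
    proof (cases "norm x = 0")
      case False
      have "rin (Y \<cdot> x) x / (norm x)\<^sup>2 \<le> c" if "c \<in> S" for c
      proof -
        have "rin (Y \<cdot> x) x \<le> c * (norm x)\<^sup>2"
          using bop_leD[of Y "c *\<^sub>R 1" x] that by (simp add: S_def rin.scaleR_left rin_self)
        then show ?thesis using False by (simp add: field_simps)
      qed
      then have "rin (Y \<cdot> x) x / (norm x)\<^sup>2 \<le> \<beta>"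
        unfolding \<beta>_def using ne by (intro cInf_greatest) auto
      then show ?thesis using False by (simp add: field_simps rin.scaleR_left rin_self)
    qed (simp add: bop_apply_zero rin.zero_left)
  qed (use assms in auto)
  then have "\<beta> \<in> S" by (simp add: S_def)
  then have "\<beta> > g" by (rule Sg)
  moreover have "\<not> bounded_below (Y - \<beta> *\<^sub>R 1)"
  proof
    assume "bounded_below (Y - \<beta> *\<^sub>R 1)"
    then have "bounded_below (\<beta> *\<^sub>R 1 - Y)"
      using bounded_below_uminus[of "Y - \<beta> *\<^sub>R 1"] by simp
    then obtain d where d: "d > 0" "d *\<^sub>R 1 \<le> \<beta> *\<^sub>R 1 - Y"
      using ge_if_bounded_below[of "\<beta> *\<^sub>R 1 - Y"] Yb by auto
    then have "Y \<le> (\<beta> - d) *\<^sub>R 1"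
      by (simp add: scaleR_diff_left le_diff_eq add.commute)
    then have "\<beta> \<le> \<beta> - d"
      unfolding \<beta>_def using bdd by (intro cInf_lower) (auto simp: S_def \<beta>_def)
    then show False using d by simp
  qed
  ultimately show ?thesis using that by blast
qed

lemma mult_scaleC_right: "S * (c *\<^sub>C T) = c *\<^sub>C (S * T :: 'a::complex_inner bop)"
  by (rule bop_eqI) (simp add: bop_apply_scaleC)

definition cpoly_bop :: "complex poly \<Rightarrow> 'a::complex_inner bop \<Rightarrow> 'a bop"
  where "cpoly_bop p T = (\<Sum>i\<le>degree p. coeff p i *\<^sub>C T ^ i)"

lemma cpoly_bop_upto: "degree p \<le> N \<Longrightarrow> cpoly_bop p T = (\<Sum>i\<le>N. coeff p i *\<^sub>C T ^ i)"
  unfolding cpoly_bop_def by (rule sum.mono_neutral_left) (auto simp: coeff_eq_0)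

lemma cpoly_bop_pCons: "cpoly_bop (pCons a p) T = a *\<^sub>C 1 + T * cpoly_bop p T"
proof -
  have "cpoly_bop (pCons a p) T = (\<Sum>i\<le>Suc (degree p). coeff (pCons a p) i *\<^sub>C T ^ i)"
    by (rule cpoly_bop_upto) (rule degree_pCons_le)
  then show ?thesis
    by (simp only: sum.atMost_Suc_shift) (simp add: cpoly_bop_def sum_distrib_left mult_scaleC_right)
qed

lemma cpoly_bop_linear_factor: "cpoly_bop ([:- z, 1:] * p) T = (T - z *\<^sub>C 1) * cpoly_bop p T"
proof -
  define N where "N = Suc (degree p)"
  have "degree ([:- z, 1:] * p) \<le> N"
    using degree_mult_le[of "[:- z, 1:]" p] by (simp add: N_def)
  then have "cpoly_bop ([:- z, 1:] * p) T = (\<Sum>i\<le>N. coeff ([:- z, 1:] * p) i *\<^sub>C T ^ i)"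
    by (rule cpoly_bop_upto)
  also have "\<dots> = (\<Sum>i\<le>N. (- z) *\<^sub>C (coeff p i *\<^sub>C T ^ i) + coeff (pCons 0 p) i *\<^sub>C T ^ i)"
    by (intro sum.cong refl)
      (simp add: scaleC_scaleC complex_vector.scale_left_diff_distrib)
  also have "\<dots> = (- z) *\<^sub>C (\<Sum>i\<le>N. coeff p i *\<^sub>C T ^ i) + (\<Sum>i\<le>N. coeff (pCons 0 p) i *\<^sub>C T ^ i)"
    by (simp only: sum.distrib complex_vector.scale_sum_right)
  also have "(\<Sum>i\<le>N. coeff p i *\<^sub>C T ^ i) = cpoly_bop p T"
    by (rule cpoly_bop_upto[symmetric]) (simp add: N_def)
  also have "(\<Sum>i\<le>N. coeff (pCons 0 p) i *\<^sub>C T ^ i) = cpoly_bop (pCons 0 p) T"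
    by (rule cpoly_bop_upto[symmetric]) (simp add: N_def degree_pCons_le)
  also have "\<dots> = T * cpoly_bop p T"
    by (simp add: cpoly_bop_pCons)
  finally show ?thesis
    by (intro bop_eqI) (simp add: complex_vector.scale_minus_left)
qed

text \<open>Spectral mapping, in the form needed here: by the fundamental theorem of algebra \<open>q(T)\<close> is
  a product of factors \<open>T - z\<close> over the roots \<open>z\<close> of \<open>q\<close>.\<close>

lemma bounded_below_cpoly_bop:
  assumes "q \<noteq> 0" "\<And>z. poly q z = 0 \<Longrightarrow> bounded_below (T - z *\<^sub>C 1)"
  shows "bounded_below (cpoly_bop q T)"
  using assms
proof (induction "degree q" arbitrary: q)
  case 0
  then obtain c where c: "q = [:c:]" "c \<noteq> 0"
    by (metis degree_eq_zeroE pCons_eq_0_iff)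
  have "cpoly_bop q T = c *\<^sub>C 1"
    by (simp add: c cpoly_bop_def)
  then show ?case using c by (intro bounded_belowI[of "norm c"]) (auto simp: norm_scaleC)
next
  case (Suc n)
  then have "\<not> constant (poly q)" by (simp add: constant_degree)
  then obtain z where z: "poly q z = 0"
    using fundamental_theorem_of_algebra by blast
  then obtain p where p: "q = [:- z, 1:] * p"
    by (meson poly_eq_0_iff_dvd dvdE)
  with Suc.prems have "p \<noteq> 0" by auto
  then have "degree q = Suc (degree p)"
    unfolding p by (subst degree_mult_eq) auto
  then have "bounded_below (cpoly_bop p T)"
    using Suc.hyps Suc.prems \<open>p \<noteq> 0\<close> p by (intro Suc.hyps(1)) auto
  then show ?case
    unfolding p cpoly_bop_linear_factor using Suc.prems(2)[OF z] by (rule bounded_below_mult[rotated])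
qed

text \<open>For self-adjoint \<open>T\<close> the forms of \<open>T - z\<close> have imaginary part \<open>- Im z\<close> times the squared norm.
  Hence only the real roots of a polynomial matter.\<close>

lemma bounded_below_nonreal:
  assumes "selfadjoint T" "Im z \<noteq> 0"
  shows "bounded_below (T - z *\<^sub>C 1)"
proof (rule bounded_belowI)
  show "\<bar>Im z\<bar> > 0" using assms by simp
  fix x
  have "rin (T \<cdot> x) (\<i> *\<^sub>C x) = Im (cinner x (T \<cdot> x))"
    using selfadjointD[OF assms(1), of x "\<i> *\<^sub>C x"] by (simp add: bop_apply_scaleC rin_scaleC_i_right)
  also have "\<dots> = - rin (T \<cdot> x) (\<i> *\<^sub>C x)"
    unfolding rin_scaleC_i_right by (subst cinner_commute) simp
  finally have "rin (T \<cdot> x) (\<i> *\<^sub>C x) = 0" by simp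
  moreover have "rin (z *\<^sub>C x) (\<i> *\<^sub>C x) = Im z * (norm x)\<^sup>2"
    unfolding rin_scaleC_i_right by (simp add: cinner_scaleC_left cinner_self)
  ultimately have "\<bar>Im z\<bar> * (norm x)\<^sup>2 = \<bar>rin ((T - z *\<^sub>C 1) \<cdot> x) (\<i> *\<^sub>C x)\<bar>"
    by (simp add: rin.diff_left abs_mult)
  also have "\<dots> \<le> norm ((T - z *\<^sub>C 1) \<cdot> x) * norm (\<i> *\<^sub>C x)"
    by (rule rin_Cauchy_Schwarz)
  finally have "\<bar>Im z\<bar> * norm x * norm x \<le> norm ((T - z *\<^sub>C 1) \<cdot> x) * norm x"
    by (simp add: norm_scaleC power2_eq_square del: bop_diff)
  then show "\<bar>Im z\<bar> * norm x \<le> norm ((T - z *\<^sub>C 1) \<cdot> x)"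
    by (cases "norm x = 0") (auto simp del: bop_diff)
qed

lemma poly_bop_upto: "degree p \<le> N \<Longrightarrow> poly_bop p T = (\<Sum>i\<le>N. coeff p i *\<^sub>R T ^ i)"
  unfolding poly_bop_def by (rule sum.mono_neutral_left) (auto simp: coeff_eq_0)

lemma poly_bop_0 [simp]: "poly_bop 0 T = 0"
  by (simp add: poly_bop_def)

lemma poly_bop_add: "poly_bop (p + q) T = poly_bop p T + poly_bop q T"
proof -
  define N where "N = max (degree p) (degree q)"
  have "degree (p + q) \<le> N" "degree p \<le> N" "degree q \<le> N"
    by (auto simp: N_def degree_add_le_max)
  then show ?thesis
    by (simp add: poly_bop_upto[of _ N] scaleR_add_left sum.distrib)
qed

lemma poly_bop_smult: "poly_bop (smult c p) T = c *\<^sub>R poly_bop p T"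
  by (simp add: poly_bop_upto[of _ "degree p"] scaleR_sum_right degree_smult_le)

lemma poly_bop_sum: "poly_bop (\<Sum>i\<in>I. p i) T = (\<Sum>i\<in>I. poly_bop (p i) T)"
  by (induction I rule: infinite_finite_induct) (auto simp: poly_bop_add)

lemma poly_bop_diff: "poly_bop (p - q) T = poly_bop p T - poly_bop q T"
  using poly_bop_add[of "p - q" q T] by simp

lemma poly_bop_pCons: "poly_bop (pCons a p) T = a *\<^sub>R 1 + T * poly_bop p T"
proof -
  have "poly_bop (pCons a p) T = (\<Sum>i\<le>Suc (degree p). coeff (pCons a p) i *\<^sub>R T ^ i)"
    by (rule poly_bop_upto) (rule degree_pCons_le)
  then show ?thesis
    by (simp only: sum.atMost_Suc_shift) (simp add: poly_bop_def sum_distrib_left)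
qed

lemma poly_bop_mult: "poly_bop (p * q) T = poly_bop p T * poly_bop q T"
  by (induction p)
    (simp_all add: poly_bop_add poly_bop_smult poly_bop_pCons distrib_right mult.assoc)

lemma selfadjoint_poly_bop [intro]: "selfadjoint T \<Longrightarrow> selfadjoint (poly_bop p T)"
  unfolding poly_bop_def by (intro selfadjoint_sum selfadjoint_scaleR selfadjoint_power)

lemma poly_bop_eq_cpoly_bop: "poly_bop p T = cpoly_bop (map_poly of_real p) T"
proof -
  have "degree (map_poly complex_of_real p) = degree p"
    by (rule degree_map_poly) auto
  then show ?thesis
    by (simp add: poly_bop_def cpoly_bop_def coeff_map_poly scaleC_of_real)
qed

lemma poly_map_poly_of_real:
  "poly (map_poly complex_of_real p) (of_real t) = of_real (poly p t)"
  by (induction p) (auto simp: map_poly_pCons)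

lemma bounded_below_poly_bop:
  assumes "selfadjoint T" "p \<noteq> 0" "\<And>t. \<not> bounded_below (T - t *\<^sub>R 1) \<Longrightarrow> poly p t \<noteq> 0"
  shows "bounded_below (poly_bop p T)"
  unfolding poly_bop_eq_cpoly_bop
proof (rule bounded_below_cpoly_bop)
  show "map_poly complex_of_real p \<noteq> 0"
    using assms(2) by (simp add: map_poly_eq_0_iff)
  fix z assume z: "poly (map_poly complex_of_real p) z = 0"
  show "bounded_below (T - z *\<^sub>C 1)"
  proof (cases "Im z = 0")
    case True
    then have "z = of_real (Re z)" by (simp add: complex_eq_iff)
    then show ?thesis using z assms(3)[of "Re z"] poly_map_poly_of_real[of p "Re z"]
      by (metis of_real_eq_0_iff scaleC_of_real)
  qed (use bounded_below_nonreal assms in blast)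
qed

lemma approximate_spectrum_nonempty:
  assumes "selfadjoint (T :: 'a::complex_inner bop)" "(1 :: 'a bop) \<noteq> 0"
  obtains t where "\<not> bounded_below (T - t *\<^sub>R 1)"
proof -
  have "\<not> T \<le> (- norm T - 1) *\<^sub>R 1"
  proof
    assume "T \<le> (- norm T - 1) *\<^sub>R 1"
    moreover have "- (norm T *\<^sub>R 1) \<le> T" using norm_le_iff[of T "norm T"] assms by simp
    ultimately have "- (norm T *\<^sub>R 1) \<le> (- norm T - 1) *\<^sub>R (1 :: 'a bop)" by simp
    then have "(1 :: 'a bop) \<le> 0" by (simp add: scaleR_diff_left)
    moreover have "(0 :: 'a bop) \<le> 1" by (simp add: bop_nonneg_iff_rin rin_self)
    ultimately show False using assms(2) by simp
  qed
  then show ?thesis using approximate_eigenvalue_above[OF assms(1)] that by blast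
qed

text \<open>If \<open>p(T)\<close> were not positive, then \<open>p(T) + \<beta>\<close> would fail to be bounded below for some \<open>\<beta> > 0\<close>,
  although \<open>p + \<beta>\<close> has no zero in the approximate point spectrum. That this spectrum is not empty
  excludes the case \<open>p = - \<beta>\<close>.\<close>

lemma poly_bop_nonneg:
  assumes T: "selfadjoint T" and p: "\<And>t. \<not> bounded_below (T - t *\<^sub>R 1) \<Longrightarrow> 0 \<le> poly p t"
  shows "0 \<le> poly_bop p (T :: 'a::complex_inner bop)"
proof (rule ccontr)
  assume not: "\<not> 0 \<le> poly_bop p T"
  then have "(1 :: 'a bop) \<noteq> 0" by (metis mult_1_left[of "poly_bop p T"] mult_zero_left[of "poly_bop p T"] order_refl)
  then obtain t where t: "\<not> bounded_below (T - t *\<^sub>R 1)"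
    using approximate_spectrum_nonempty[OF T] by blast
  obtain \<beta> where b: "\<beta> > 0" "\<not> bounded_below (- poly_bop p T - \<beta> *\<^sub>R 1)"
    using approximate_eigenvalue_above[of "- poly_bop p T" 0] T not by auto
  have "- poly_bop p T - \<beta> *\<^sub>R 1 = - poly_bop (p + [:\<beta>:]) T"
    by (simp add: poly_bop_add poly_bop_pCons)
  then have "\<not> bounded_below (poly_bop (p + [:\<beta>:]) T)"
    using b(2) by simp
  moreover have "poly (p + [:\<beta>:]) t \<noteq> 0" if "\<not> bounded_below (T - t *\<^sub>R 1)" for t
    using p[OF that] b(1) by simp
  moreover from this[OF t] have "p + [:\<beta>:] \<noteq> 0" by force
  ultimately show False using bounded_below_poly_bop[OF T] by blast
qed

lemma minus_le_iff_add: "- S \<le> T \<longleftrightarrow> 0 \<le> T + (S::'a::complex_inner bop)"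
proof -
  have "T - (- S) = T + S" by simp
  then show ?thesis using diff_ge_0_iff_ge[of T "- S"] by simp
qed

lemma norm_poly_bop_le:
  assumes T: "selfadjoint T" and "0 \<le> e" and p: "\<And>t. \<not> bounded_below (T - t *\<^sub>R 1) \<Longrightarrow> \<bar>poly p t\<bar> \<le> e"
  shows "norm (poly_bop p T) \<le> e"
proof -
  have "0 \<le> poly_bop ([:e:] - p) T" "0 \<le> poly_bop ([:e:] + p) T"
    by (rule poly_bop_nonneg[OF T], use p in \<open>force simp: abs_le_iff\<close>)+
  then have "poly_bop p T \<le> e *\<^sub>R 1" "- poly_bop p T \<le> e *\<^sub>R 1"
    unfolding poly_bop_diff poly_bop_add poly_bop_pCons
    by (simp_all add: minus_le_iff_add)
  then show ?thesis
    using T \<open>0 \<le> e\<close> norm_le_iff[of "poly_bop p T" e] by (simp add: selfadjoint_poly_bop minus_le_iff)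
qed

section \<open>Continuous functional calculus on an interval\<close>

lemma approximate_spectrum_interval:
  assumes "a *\<^sub>R 1 \<le> T" "T \<le> b *\<^sub>R 1" "\<not> bounded_below (T - t *\<^sub>R 1)"
  shows "t \<in> {a..b}"
proof -
  have "a \<le> t"
  proof (rule ccontr)
    assume "\<not> a \<le> t"
    then have "a - t > 0" by simp
    moreover have "(a - t) *\<^sub>R 1 \<le> T - t *\<^sub>R 1"
      using assms(1) by (simp add: scaleR_diff_left)
    ultimately have "bounded_below (T - t *\<^sub>R 1)"
      by (meson bounded_below_if_ge bounded_belowI)
    then show False using assms(3) by blast
  qed
  moreover have "t \<le> b"
  proof (rule ccontr)
    assume "\<not> t \<le> b"
    then have "t - b > 0" by simp
    moreover have "(t - b) *\<^sub>R 1 \<le> t *\<^sub>R 1 - T"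
      using assms(2) by (simp add: scaleR_diff_left)
    ultimately have "bounded_below (- (T - t *\<^sub>R 1))"
      by (metis bounded_below_if_ge bounded_belowI minus_diff_eq)
    then show False using assms(3) by (simp only: bounded_below_uminus)
  qed
  ultimately show ?thesis by simp
qed

lemma poly_bop_limit_exists:
  assumes T: "selfadjoint (T :: 'a::chilbert_space bop)"
    and p: "uniform_limit X (\<lambda>n. poly (p n)) f sequentially"
    and X: "{t. \<not> bounded_below (T - t *\<^sub>R 1)} \<subseteq> X"
  obtains S where "(\<lambda>n. poly_bop (p n) T) \<longlonglongrightarrow> S"
proof -
  have "uniformly_Cauchy_on X (\<lambda>n. poly (p n))"
    using p by (intro uniformly_convergent_Cauchy uniformly_convergentI)
  then have C: "\<exists>N. \<forall>x\<in>X. \<forall>m\<ge>N. \<forall>n\<ge>N. dist (poly (p m) x) (poly (p n) x) < e" if "e > 0" for e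
    using that unfolding uniformly_Cauchy_on_def by blast
  have "Cauchy (\<lambda>n. poly_bop (p n) T)"
  proof (rule CauchyI)
    fix e :: real assume "e > 0"
    then obtain N where N: "\<forall>x\<in>X. \<forall>m\<ge>N. \<forall>n\<ge>N. dist (poly (p m) x) (poly (p n) x) < e / 2"
      using C[of "e / 2"] by auto
    have "norm (poly_bop (p m) T - poly_bop (p n) T) < e" if "m \<ge> N" "n \<ge> N" for m n
    proof -
      have "norm (poly_bop (p m - p n) T) \<le> e / 2"
      proof (rule norm_poly_bop_le[OF T])
        fix t assume "\<not> bounded_below (T - t *\<^sub>R 1)"
        then have "t \<in> X" using X by blast
        then show "\<bar>poly (p m - p n) t\<bar> \<le> e / 2"
          using N that by (force simp: dist_real_def intro: less_imp_le)
      qed (use \<open>e > 0\<close> in simp)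
      then show ?thesis using \<open>e > 0\<close> by (simp add: poly_bop_diff)
    qed
    then show "\<exists>N. \<forall>m\<ge>N. \<forall>n\<ge>N. norm (poly_bop (p m) T - poly_bop (p n) T) < e" by blast
  qed
  then show ?thesis using that Cauchy_convergent_iff unfolding convergent_def by blast
qed

text \<open>Uniform convergence on any superset \<open>X\<close> of the approximate point spectrum determines the limit. Two
  choices of \<open>X\<close> matter: an interval, on which polynomials are easy to find, and the
  spectrum itself, on which the functional calculus is defined.\<close>

lemma poly_bop_limit_unique:
  assumes T: "selfadjoint (T :: 'a::chilbert_space bop)"
    and p: "uniform_limit X (\<lambda>n. poly (p n)) f sequentially"
    and q: "uniform_limit X (\<lambda>n. poly (q n)) f sequentially"
    and X: "{t. \<not> bounded_below (T - t *\<^sub>R 1)} \<subseteq> X"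
    and S: "(\<lambda>n. poly_bop (p n) T) \<longlonglongrightarrow> S"
  shows "(\<lambda>n. poly_bop (q n) T) \<longlonglongrightarrow> S"
proof -
  have u: "uniform_limit X (\<lambda>n t. poly (q n) t - poly (p n) t) (\<lambda>t. f t - f t) sequentially"
    by (intro uniform_limit_minus p q)
  have "(\<lambda>n. poly_bop (q n - p n) T) \<longlonglongrightarrow> 0"
  proof (rule tendstoI)
    fix e :: real assume "e > 0"
    then have "\<forall>\<^sub>F n in sequentially. \<forall>x\<in>X. dist (poly (q n) x - poly (p n) x) (f x - f x) < e / 2"
      using uniform_limitD[OF u, of "e / 2"] by simp
    then show "\<forall>\<^sub>F n in sequentially. dist (poly_bop (q n - p n) T) 0 < e"
    proof eventually_elim
      case (elim n)
      have "norm (poly_bop (q n - p n) T) \<le> e / 2"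
      proof (rule norm_poly_bop_le[OF T])
        fix t assume "\<not> bounded_below (T - t *\<^sub>R 1)"
        then have "t \<in> X" using X by blast
        then show "\<bar>poly (q n - p n) t\<bar> \<le> e / 2"
          using elim by (force simp: dist_real_def intro: less_imp_le)
      qed (use \<open>e > 0\<close> in simp)
      then show ?case using \<open>e > 0\<close> by simp
    qed
  qed
  from tendsto_add[OF this S] show ?thesis
    by (simp add: poly_bop_diff)
qed

text \<open>The Bernstein polynomials of the interval \<open>[a, b]\<close>. Besides uniform approximation they provide a
  partition of unity by functions that are nonnegative on the interval.\<close>

definition bernstein_poly :: "real \<Rightarrow> real \<Rightarrow> nat \<Rightarrow> nat \<Rightarrow> real poly"
  where "bernstein_poly a b n k = smult (of_nat (n choose k))
    ([:- a / (b - a), 1 / (b - a):] ^ k * [:b / (b - a), - 1 / (b - a):] ^ (n - k))"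

definition bernstein_node :: "real \<Rightarrow> real \<Rightarrow> nat \<Rightarrow> nat \<Rightarrow> real"
  where "bernstein_node a b n k = a + (b - a) * (k / n)"

definition bernstein_approx :: "(real \<Rightarrow> real) \<Rightarrow> real \<Rightarrow> real \<Rightarrow> nat \<Rightarrow> real poly"
  where "bernstein_approx f a b n =
    (\<Sum>k\<le>n. smult (f (bernstein_node a b n k)) (bernstein_poly a b n k))"

lemma poly_bernstein_poly:
  "a < b \<Longrightarrow> poly (bernstein_poly a b n k) t = Bernstein n k ((t - a) / (b - a))"
proof -
  assume "a < b"
  then have "1 - (t - a) / (b - a) = (b - t) / (b - a)" by (simp add: field_simps)
  then have "1 - (t - a) / (b - a) = b / (b - a) + t * (- 1 / (b - a))" by (simp add: diff_divide_distrib)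
  moreover have "(t - a) / (b - a) = - a / (b - a) + t * (1 / (b - a))" by (simp add: diff_divide_distrib)
  ultimately show ?thesis
    unfolding bernstein_poly_def Bernstein_def by (simp only: poly_smult poly_mult poly_power poly_pCons poly_0) simp
qed

lemma bernstein_poly_nonneg:
  assumes "a < b" "t \<in> {a..b}"
  shows "0 \<le> poly (bernstein_poly a b n k) t"
  unfolding poly_bernstein_poly[OF assms(1)] using assms by (intro Bernstein_nonneg) auto

lemma bernstein_approx_limit:
  assumes "a < b" "continuous_on {a..b} f"
  shows "uniform_limit {a..b} (\<lambda>n. poly (bernstein_approx f a b n)) f sequentially"
proof (rule uniform_limitI)
  fix e :: real assume "e > 0"
  have "(\<lambda>s. a + (b - a) * s) ` {0..1} \<subseteq> {a..b}"
    using assms(1) by (auto simp: mult_left_le)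
      (metis diff_add_cancel add.commute add_le_cancel_left diff_ge_0_iff_ge less_imp_le mult_left_le)
  then have "continuous_on {0..1} (\<lambda>s. f (a + (b - a) * s))"
    by (intro continuous_on_compose2[OF assms(2)] continuous_intros)
  then obtain N where N: "\<And>n s. N \<le> n \<Longrightarrow> s \<in> {0..1} \<Longrightarrow>
      \<bar>f (a + (b - a) * s) - (\<Sum>k\<le>n. f (a + (b - a) * (k / n)) * Bernstein n k s)\<bar> < e"
    using Bernstein_Weierstrass[of "\<lambda>s. f (a + (b - a) * s)" e] \<open>e > 0\<close> by metis
  show "\<forall>\<^sub>F n in sequentially. \<forall>t\<in>{a..b}. dist (poly (bernstein_approx f a b n) t) (f t) < e"
    unfolding eventually_sequentially
  proof (intro exI[of _ N] allI impI ballI)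
    fix n t assume n: "N \<le> n" and t: "t \<in> {a..b}"
    have s: "(t - a) / (b - a) \<in> {0..1}" using t assms(1) by auto
    have "a + (b - a) * ((t - a) / (b - a)) = t" using assms(1) by simp
    moreover have "poly (bernstein_approx f a b n) t =
        (\<Sum>k\<le>n. f (a + (b - a) * (k / n)) * Bernstein n k ((t - a) / (b - a)))"
      using assms(1) by (simp add: bernstein_approx_def bernstein_node_def poly_sum poly_bernstein_poly)
    ultimately show "dist (poly (bernstein_approx f a b n) t) (f t) < e"
      using N[OF n s] by (simp add: dist_real_def abs_minus_commute)
  qed
qed

text \<open>Polynomials \<open>p\<^sub>n\<close> that converge to \<open>1 / t\<close> give operators \<open>p\<^sub>n(P)\<close> that converge to an inverse;
  here completeness enters. This is what confines the full spectrum of a self-adjoint operator, and not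
  only its approximate point spectrum, to an interval.\<close>

lemma invertible_if_ge:
  assumes "d > 0" "d *\<^sub>R 1 \<le> (P :: 'a::chilbert_space bop)"
  obtains S where "S * P = 1" "P * S = 1"
proof -
  define b where "b = norm P + d"
  have P: "selfadjoint P" using selfadjoint_le_right[OF assms(2)] by auto
  have "P \<le> norm P *\<^sub>R 1" by (rule selfadjoint_le_norm[OF P])
  also have "\<dots> \<le> b *\<^sub>R 1"
    using assms by (intro bop_leI) (auto simp: b_def rin.scaleR_left rin_self mult_right_mono)
  finally have Pb: "P \<le> b *\<^sub>R 1" .
  \<comment> \<open>the interval must not degenerate, even on the zero space\<close>
  define b' where "b' = b + d"
  have db: "d < b'" using assms by (simp add: b'_def b_def add_nonneg_pos add.commute[of d])
  have "b *\<^sub>R 1 \<le> b' *\<^sub>R (1 :: 'a bop)"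
    using assms by (intro bop_leI) (auto simp: b'_def rin.scaleR_left rin_self mult_right_mono)
  with Pb have Pb': "P \<le> b' *\<^sub>R 1" by simp
  have X: "{t. \<not> bounded_below (P - t *\<^sub>R 1)} \<subseteq> {d..b'}"
    using approximate_spectrum_interval[OF assms(2) Pb'] by blast
  have "continuous_on {d..b'} (\<lambda>t. 1 / t)"
    using assms by (intro continuous_intros) auto
  then obtain p :: "nat \<Rightarrow> real poly" where
    p: "uniform_limit {d..b'} (\<lambda>n. poly (p n)) (\<lambda>t. 1 / t) sequentially"
    using bernstein_approx_limit[OF db] by blast
  obtain S where S: "(\<lambda>n. poly_bop (p n) P) \<longlonglongrightarrow> S"
    using poly_bop_limit_exists[OF P p X] by blast
  have u: "uniform_limit {d..b'} (\<lambda>n. poly ([:0, 1:] * p n)) (\<lambda>t. 1) sequentially"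
  proof -
    have "uniform_limit {d..b'} (\<lambda>n t. t * poly (p n) t) (\<lambda>t. t * (1 / t)) sequentially"
    proof (intro uniform_lim_mult p uniform_limit_const)
      show "bounded ((\<lambda>t. 1 / t) ` {d..b'})"
        by (intro compact_imp_bounded compact_continuous_image) (use assms in \<open>auto intro!: continuous_intros\<close>)
    qed auto
    then show ?thesis
      by (rule uniform_limit_cong'[THEN iffD1, rotated -1]) (use assms in auto)
  qed
  have "(\<lambda>n. poly_bop ([:0, 1:] * p n) P) \<longlonglongrightarrow> 1"
  proof (rule poly_bop_limit_unique[OF P _ u X, of "\<lambda>_. [:1:]"])
    have "poly [:1:] = (\<lambda>t::real. 1::real)" by (simp add: fun_eq_iff)
    then show "uniform_limit {d..b'} (\<lambda>n. poly [:1:]) (\<lambda>t. 1) sequentially"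
      by (simp add: uniform_limit_const)
  qed (simp add: poly_bop_pCons)
  moreover have "poly_bop ([:0, 1:] * p n) P = P * poly_bop (p n) P" for n
    by (simp add: poly_bop_mult poly_bop_pCons)
  moreover have "poly_bop ([:0, 1:] * p n) P = poly_bop (p n) P * P" for n
    by (subst mult.commute) (simp only: poly_bop_mult, simp add: poly_bop_pCons)
  ultimately have "(\<lambda>n. P * poly_bop (p n) P) \<longlonglongrightarrow> 1" "(\<lambda>n. poly_bop (p n) P * P) \<longlonglongrightarrow> 1"
    by simp_all
  moreover have "(\<lambda>n. P * poly_bop (p n) P) \<longlonglongrightarrow> P * S" "(\<lambda>n. poly_bop (p n) P * P) \<longlonglongrightarrow> S * P"
    by (intro tendsto_intros S)+
  ultimately have "P * S = 1" "S * P = 1"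
    using LIMSEQ_unique by blast+
  then show ?thesis using that by blast
qed

lemma spectrum_interval:
  assumes "a *\<^sub>R 1 \<le> (T :: 'a::chilbert_space bop)" "T \<le> b *\<^sub>R 1" "complex_of_real t \<in> spectrum T"
  shows "t \<in> {a..b}"
proof -
  have ni: "\<not> (\<exists>S. S * (T - t *\<^sub>R 1) = 1 \<and> (T - t *\<^sub>R 1) * S = 1)"
    using assms(3) by (simp add: spectrum_def bop_invertible_def scaleC_of_real)
  have "a \<le> t"
  proof (rule ccontr)
    assume "\<not> a \<le> t"
    then have "a - t > 0" by simp
    moreover have "(a - t) *\<^sub>R 1 \<le> T - t *\<^sub>R 1"
      using assms(1) by (simp add: scaleR_diff_left)
    ultimately show False using invertible_if_ge ni by metis
  qed
  moreover have "t \<le> b"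
  proof (rule ccontr)
    assume "\<not> t \<le> b"
    then have "t - b > 0" by simp
    moreover have "(t - b) *\<^sub>R 1 \<le> t *\<^sub>R 1 - T"
      using assms(2) by (simp add: scaleR_diff_left)
    ultimately obtain S where "S * (t *\<^sub>R 1 - T) = 1" "(t *\<^sub>R 1 - T) * S = 1"
      using invertible_if_ge by metis
    then have "(- S) * (T - t *\<^sub>R 1) = 1" "(T - t *\<^sub>R 1) * (- S) = 1"
      by (simp_all add: algebra_simps)
    then show False using ni by blast
  qed
  ultimately show ?thesis by simp
qed

text \<open>Strictness of \<open>a < b\<close> is needed to rescale the interval to \<open>[0, 1]\<close>; it can always be arranged by
  enlarging \<open>b\<close>. The value of the functional calculus depends on \<open>T\<close> alone, so different intervals may
  be used for the same operator.\<close>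

locale spectral_interval =
  fixes T :: "'a::chilbert_space bop" and a b :: real
  assumes a_less_b: "a < b" and lower: "a *\<^sub>R 1 \<le> T" and upper: "T \<le> b *\<^sub>R 1"
begin

lemma selfadjoint_op: "selfadjoint T"
  using selfadjoint_le_right[OF lower] by auto

lemma approximate_spectrum_subset: "{t. \<not> bounded_below (T - t *\<^sub>R 1)} \<subseteq> {a..b}"
  using approximate_spectrum_interval[OF lower upper] by blast

lemma poly_nonneg: "(\<And>t. t \<in> {a..b} \<Longrightarrow> 0 \<le> poly p t) \<Longrightarrow> 0 \<le> poly_bop p T"
  using approximate_spectrum_subset by (intro poly_bop_nonneg[OF selfadjoint_op]) blast

text \<open>The definition of \<open>fun_calc\<close> refers to approximation on the spectrum only. Polynomials
  that converge on \<open>[a, b]\<close> are admissible there because the spectrum lies in the interval, and all admissible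
  sequences give the same operator because the spectrum contains the approximate point spectrum.\<close>

lemma calc_limit:
  assumes p: "uniform_limit {a..b} (\<lambda>n. poly (p n)) f sequentially"
  shows "(\<lambda>n. poly_bop (p n) T) \<longlonglongrightarrow> fun_calc f T"
proof -
  define X where "X = {t. complex_of_real t \<in> spectrum T}"
  have X: "X \<subseteq> {a..b}" using spectrum_interval[OF lower upper] by (auto simp: X_def)
  have X': "{t. \<not> bounded_below (T - t *\<^sub>R 1)} \<subseteq> X"
    using not_bounded_below_spectrum by (auto simp: X_def)
  obtain S where S: "(\<lambda>n. poly_bop (p n) T) \<longlonglongrightarrow> S"
    using poly_bop_limit_exists[OF selfadjoint_op p approximate_spectrum_subset] by blast
  have pX: "uniform_limit X (\<lambda>n. poly (p n)) f sequentially"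
    by (rule uniform_limit_on_subset[OF p X])
  have "fun_calc f T = S"
    unfolding fun_calc_def X_def[symmetric]
  proof (rule the_equality)
    fix S' assume "\<exists>q. uniform_limit X (\<lambda>n. poly (q n)) f sequentially \<and> (\<lambda>n. poly_bop (q n) T) \<longlonglongrightarrow> S'"
    then obtain q where "uniform_limit X (\<lambda>n. poly (q n)) f sequentially" "(\<lambda>n. poly_bop (q n) T) \<longlonglongrightarrow> S'"
      by blast
    then show "S' = S"
      using poly_bop_limit_unique[OF selfadjoint_op pX _ X' S] LIMSEQ_unique by blast
  qed (use pX S in blast)
  then show ?thesis using S by simp
qed

lemma calc_bernstein:
  "continuous_on {a..b} f \<Longrightarrow> (\<lambda>n. poly_bop (bernstein_approx f a b n) T) \<longlonglongrightarrow> fun_calc f T"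
  by (intro calc_limit bernstein_approx_limit a_less_b)

lemma calc_selfadjoint: "continuous_on {a..b} f \<Longrightarrow> selfadjoint (fun_calc f T)"
  by (rule selfadjoint_limit[OF calc_bernstein]) (auto intro: selfadjoint_op)

lemma calc_poly: "fun_calc (poly p) T = poly_bop p T"
  by (rule LIMSEQ_unique[OF calc_limit[of "\<lambda>_. p"]]) (auto intro: uniform_limit_const)

lemma calc_const: "fun_calc (\<lambda>_. c) T = c *\<^sub>R 1"
proof -
  have "poly [:c:] = (\<lambda>_. c)" by (simp add: fun_eq_iff)
  then show ?thesis using calc_poly[of "[:c:]"] by (simp add: poly_bop_pCons)
qed

lemma calc_id: "fun_calc (\<lambda>t. t) T = T"
proof -
  have "poly [:0, 1:] = (\<lambda>t::real. t)" by (simp add: fun_eq_iff)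
  then show ?thesis using calc_poly[of "[:0, 1:]"] by (simp add: poly_bop_pCons)
qed

lemma calc_add:
  assumes f: "continuous_on {a..b} f" and g: "continuous_on {a..b} g"
  shows "fun_calc (\<lambda>t. f t + g t) T = fun_calc f T + fun_calc g T"
proof (rule LIMSEQ_unique[OF calc_limit])
  show "uniform_limit {a..b} (\<lambda>n. poly (bernstein_approx f a b n + bernstein_approx g a b n))
      (\<lambda>t. f t + g t) sequentially"
    unfolding poly_add using assms by (intro uniform_limit_add bernstein_approx_limit a_less_b)
  show "(\<lambda>n. poly_bop (bernstein_approx f a b n + bernstein_approx g a b n) T)
      \<longlonglongrightarrow> fun_calc f T + fun_calc g T"
    unfolding poly_bop_add using assms by (intro tendsto_add calc_bernstein)
qed

lemma calc_mult:
  assumes f: "continuous_on {a..b} f" and g: "continuous_on {a..b} g"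
  shows "fun_calc (\<lambda>t. f t * g t) T = fun_calc f T * fun_calc g T"
proof (rule LIMSEQ_unique[OF calc_limit])
  have bdd: "bounded (h ` {a..b})" if "continuous_on {a..b} h" for h :: "real \<Rightarrow> real"
    using that by (intro compact_imp_bounded compact_continuous_image) auto
  show "uniform_limit {a..b} (\<lambda>n. poly (bernstein_approx f a b n * bernstein_approx g a b n))
      (\<lambda>t. f t * g t) sequentially"
    unfolding poly_mult using assms by (intro uniform_lim_mult bernstein_approx_limit a_less_b bdd)
  show "(\<lambda>n. poly_bop (bernstein_approx f a b n * bernstein_approx g a b n) T)
      \<longlonglongrightarrow> fun_calc f T * fun_calc g T"
    unfolding poly_bop_mult using assms by (intro tendsto_mult calc_bernstein)
qed

lemma calc_scaleR: "continuous_on {a..b} f \<Longrightarrow> fun_calc (\<lambda>t. c * f t) T = c *\<^sub>R fun_calc f T"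
  using calc_mult[of "\<lambda>_. c" f] by (simp add: calc_const)

lemma calc_diff:
  "continuous_on {a..b} f \<Longrightarrow> continuous_on {a..b} g \<Longrightarrow>
    fun_calc (\<lambda>t. f t - g t) T = fun_calc f T - fun_calc g T"
  using calc_add[of f "\<lambda>t. (-1) * g t"] calc_scaleR[of g "-1"]
  by (simp add: continuous_on_minus)

lemma calc_nonneg:
  assumes "continuous_on {a..b} f" "\<And>t. t \<in> {a..b} \<Longrightarrow> 0 \<le> f t"
  shows "0 \<le> fun_calc f T"
proof (rule nonneg_limit[OF calc_bernstein[OF assms(1)]])
  fix n
  have "bernstein_node a b n k \<in> {a..b}" if "k \<le> n" for k
  proof -
    have "real k / real n \<le> 1" using that by (simp add: divide_le_eq)
    then have "(b - a) * (real k / real n) \<le> b - a" using a_less_b by (intro mult_left_le) auto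
    moreover have "0 \<le> (b - a) * (real k / real n)" using a_less_b by simp
    ultimately show ?thesis unfolding bernstein_node_def atLeastAtMost_iff by linarith
  qed
  then have "0 \<le> poly (bernstein_approx f a b n) t" if "t \<in> {a..b}" for t
    unfolding bernstein_approx_def poly_sum poly_smult using that assms(2)
    by (intro sum_nonneg mult_nonneg_nonneg bernstein_poly_nonneg a_less_b) auto
  then show "0 \<le> poly_bop (bernstein_approx f a b n) T" by (rule poly_nonneg)
qed

lemma calc_mono:
  assumes "continuous_on {a..b} f" "continuous_on {a..b} g" "\<And>t. t \<in> {a..b} \<Longrightarrow> f t \<le> g t"
  shows "fun_calc f T \<le> fun_calc g T"
  using calc_nonneg[of "\<lambda>t. g t - f t"] assms calc_diff[of g f] by (simp add: continuous_on_diff)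

lemma calc_cong:
  assumes "\<And>t. t \<in> {a..b} \<Longrightarrow> f t = g t" "continuous_on {a..b} g"
  shows "fun_calc f T = fun_calc g T"
proof -
  have "continuous_on {a..b} f" using assms continuous_on_cong by metis
  then show ?thesis using assms by (intro antisym calc_mono) auto
qed

lemma calc_norm_le:
  assumes "continuous_on {a..b} f" "0 \<le> e" "\<And>t. t \<in> {a..b} \<Longrightarrow> \<bar>f t\<bar> \<le> e"
  shows "norm (fun_calc f T) \<le> e"
proof -
  have "fun_calc f T \<le> e *\<^sub>R 1"
    using calc_mono[of f "\<lambda>_. e"] assms by (force simp: calc_const abs_le_iff)
  moreover have "- (e *\<^sub>R 1) \<le> fun_calc f T"
    using calc_mono[of "\<lambda>_. - e" f] assms by (force simp: calc_const abs_le_iff)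
  ultimately show ?thesis using norm_le_iff calc_selfadjoint assms by blast
qed

text \<open>For polynomials \<open>g\<close> this is multiplicativity; in general \<open>g\<close> is a uniform limit of polynomials on
  \<open>[c, d]\<close>, and composing with \<open>f\<close> preserves uniform convergence.\<close>

lemma calc_compose:
  assumes f: "continuous_on {a..b} f" and cd: "c < d" "\<And>t. t \<in> {a..b} \<Longrightarrow> f t \<in> {c..d}"
    and g: "continuous_on {c..d} g"
  shows "fun_calc g (fun_calc f T) = fun_calc (\<lambda>t. g (f t)) T"
proof -
  have "c *\<^sub>R 1 \<le> fun_calc f T" "fun_calc f T \<le> d *\<^sub>R 1"
    using calc_mono[of "\<lambda>_. c" f] calc_mono[of f "\<lambda>_. d"] f cd by (auto simp: calc_const)
  then interpret F: spectral_interval "fun_calc f T" c d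
    using cd by unfold_locales
  have cp: "continuous_on {a..b} (\<lambda>t. poly p (f t))" for p
    by (intro continuous_intros f)
  have gf: "continuous_on {a..b} (\<lambda>t. g (f t))"
    using cd by (intro continuous_on_compose2[OF g f]) auto
  have poly: "poly_bop p (fun_calc f T) = fun_calc (\<lambda>t. poly p (f t)) T" for p
  proof (induction p)
    case 0
    then show ?case by (simp add: calc_const)
  next
    case (pCons u p)
    have "fun_calc (\<lambda>t. u + f t * poly p (f t)) T = u *\<^sub>R 1 + fun_calc f T * fun_calc (\<lambda>t. poly p (f t)) T"
      by (subst calc_add) (auto intro!: continuous_intros f simp: calc_const calc_mult cp f)
    then show ?case by (simp add: poly_bop_pCons pCons)
  qed
  define p where "p n = bernstein_approx g c d n" for n
  have u: "uniform_limit {c..d} (\<lambda>n. poly (p n)) g sequentially"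
    unfolding p_def by (intro bernstein_approx_limit cd g)
  have "(\<lambda>n. fun_calc (\<lambda>t. poly (p n) (f t)) T) \<longlonglongrightarrow> fun_calc (\<lambda>t. g (f t)) T"
  proof (rule tendstoI)
    fix e :: real assume "e > 0"
    then have "\<forall>\<^sub>F n in sequentially. \<forall>x\<in>{c..d}. dist (poly (p n) x) (g x) < e / 2"
      using uniform_limitD[OF u, of "e / 2"] by simp
    then show "\<forall>\<^sub>F n in sequentially. dist (fun_calc (\<lambda>t. poly (p n) (f t)) T) (fun_calc (\<lambda>t. g (f t)) T) < e"
    proof eventually_elim
      case (elim n)
      have "norm (fun_calc (\<lambda>t. poly (p n) (f t) - g (f t)) T) \<le> e / 2"
        using elim cd(2) \<open>e > 0\<close>
        by (intro calc_norm_le continuous_on_diff cp gf) (force simp: dist_real_def intro: less_imp_le)+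
      then show ?case using \<open>e > 0\<close> by (simp add: calc_diff cp gf dist_norm)
    qed
  qed
  moreover have "(\<lambda>n. fun_calc (\<lambda>t. poly (p n) (f t)) T) \<longlonglongrightarrow> fun_calc g (fun_calc f T)"
    using F.calc_limit[OF u] by (simp add: poly)
  ultimately show ?thesis using LIMSEQ_unique by blast
qed

end

section \<open>Real powers of positive definite operators\<close>

definition posdef :: "'a::complex_inner bop \<Rightarrow> bool"
  where "posdef A \<longleftrightarrow> (\<exists>d>0. d *\<^sub>R 1 \<le> A)"

lemma posdef_selfadjoint: "posdef A \<Longrightarrow> selfadjoint A"
  unfolding posdef_def using selfadjoint_le_right by blast

lemma scaleR_one_nonneg: "0 \<le> d \<Longrightarrow> 0 \<le> d *\<^sub>R (1 :: 'a::complex_inner bop)"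
  by (simp add: bop_nonneg_iff_rin rin.scaleR_left rin_self)

lemma scaleR_one_mono: "c \<le> d \<Longrightarrow> c *\<^sub>R (1 :: 'a::complex_inner bop) \<le> d *\<^sub>R 1"
  by (intro bop_leI) (auto simp: rin.scaleR_left rin_self mult_right_mono)

lemma posdef_nonneg: "posdef A \<Longrightarrow> 0 \<le> A"
  unfolding posdef_def using scaleR_one_nonneg order_trans less_imp_le by metis

lemma posdef_mono: "posdef A \<Longrightarrow> A \<le> B \<Longrightarrow> posdef B"
  unfolding posdef_def by (meson order_trans)

lemma posdef_interval:
  assumes "posdef (A :: 'a::chilbert_space bop)"
  obtains a b where "0 < a" "spectral_interval A a b"
proof -
  obtain a where a: "0 < a" "a *\<^sub>R 1 \<le> A" using assms unfolding posdef_def by blast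
  have "A \<le> norm A *\<^sub>R 1" by (rule selfadjoint_le_norm[OF posdef_selfadjoint[OF assms]])
  also have "\<dots> \<le> (norm A + a + 1) *\<^sub>R 1" using a by (intro scaleR_one_mono) simp
  finally have "spectral_interval A a (norm A + a + 1)"
    using a by unfold_locales (auto simp: add_nonneg_pos add.commute[of _ a])
  then show ?thesis using that a by blast
qed

lemma continuous_on_powr_pos: "0 < a \<Longrightarrow> continuous_on {a..b} (\<lambda>t::real. t powr s)"
  by (intro continuous_intros) auto

lemma powr_range:
  assumes "0 < a" "a < (b::real)"
  obtains c d where "0 < c" "c < d" "\<And>t. t \<in> {a..b} \<Longrightarrow> t powr s \<in> {c..d}"
proof -
  have ne: "{a..b} \<noteq> {}" using assms by simp
  obtain x where x: "x \<in> {a..b}" "\<forall>t\<in>{a..b}. x powr s \<le> t powr s"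
    using continuous_attains_inf[OF compact_Icc ne continuous_on_powr_pos[OF assms(1)]] by blast
  obtain y where y: "y \<in> {a..b}" "\<forall>t\<in>{a..b}. t powr s \<le> y powr s"
    using continuous_attains_sup[OF compact_Icc ne continuous_on_powr_pos[OF assms(1)]] by blast
  show ?thesis
  proof (rule that)
    show "0 < x powr s" using x assms by auto
    show "x powr s < y powr s + 1" using x y by fastforce
    show "t powr s \<in> {x powr s..y powr s + 1}" if "t \<in> {a..b}" for t
      using that x y by fastforce
  qed
qed

lemma posdef_bop_powr:
  assumes "posdef (A :: 'a::chilbert_space bop)"
  shows "posdef (bop_powr A s)"
proof -
  obtain a b where a: "0 < a" and I: "spectral_interval A a b" using posdef_interval assms by blast
  interpret spectral_interval A a b by (rule I)
  obtain c d where c: "0 < c" "\<And>t. t \<in> {a..b} \<Longrightarrow> t powr s \<in> {c..d}"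
    using powr_range[OF a a_less_b] by metis
  have "c *\<^sub>R 1 \<le> bop_powr A s"
    unfolding bop_powr_def using c(2) calc_mono[of "\<lambda>_. c" "\<lambda>t. t powr s"] continuous_on_powr_pos[OF a]
    by (auto simp: calc_const)
  then show ?thesis using c unfolding posdef_def by blast
qed

lemma selfadjoint_bop_powr: "posdef (A :: 'a::chilbert_space bop) \<Longrightarrow> selfadjoint (bop_powr A s)"
  by (intro posdef_selfadjoint posdef_bop_powr)

lemma bop_powr_add:
  assumes "posdef (A :: 'a::chilbert_space bop)"
  shows "bop_powr A s * bop_powr A t = bop_powr A (s + t)"
proof -
  obtain a b where a: "0 < a" and I: "spectral_interval A a b" using posdef_interval assms by blast
  interpret spectral_interval A a b by (rule I)
  show ?thesis unfolding bop_powr_def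
    by (simp add: calc_mult[symmetric] continuous_on_powr_pos[OF a] powr_add)
qed

lemma bop_powr_zero:
  assumes "posdef (A :: 'a::chilbert_space bop)"
  shows "bop_powr A 0 = 1"
proof -
  obtain a b where a: "0 < a" and I: "spectral_interval A a b" using posdef_interval assms by blast
  interpret spectral_interval A a b by (rule I)
  have "bop_powr A 0 = fun_calc (\<lambda>_. 1) A"
    unfolding bop_powr_def using a by (intro calc_cong) auto
  then show ?thesis by (simp add: calc_const)
qed

lemma bop_powr_one:
  assumes "posdef (A :: 'a::chilbert_space bop)"
  shows "bop_powr A 1 = A"
proof -
  obtain a b where a: "0 < a" and I: "spectral_interval A a b" using posdef_interval assms by blast
  interpret spectral_interval A a b by (rule I)
  have "bop_powr A 1 = fun_calc (\<lambda>t. t) A"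
    unfolding bop_powr_def using a by (intro calc_cong) auto
  then show ?thesis by (simp add: calc_id)
qed

lemma bop_powr_minus:
  assumes "posdef (A :: 'a::chilbert_space bop)"
  shows "bop_powr A s * bop_powr A (- s) = 1" "bop_powr A (- s) * bop_powr A s = 1"
  by (simp_all add: bop_powr_add assms bop_powr_zero)

lemma bop_powr_powr:
  assumes "posdef (A :: 'a::chilbert_space bop)"
  shows "bop_powr (bop_powr A s) t = bop_powr A (s * t)"
proof -
  obtain a b where a: "0 < a" and I: "spectral_interval A a b" using posdef_interval assms by blast
  interpret spectral_interval A a b by (rule I)
  obtain c d where c: "0 < c" "c < d" "\<And>t. t \<in> {a..b} \<Longrightarrow> t powr s \<in> {c..d}"
    using powr_range[OF a a_less_b, where s = s] by blast
  show ?thesis unfolding bop_powr_def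
    using calc_compose[OF continuous_on_powr_pos[OF a] c(2,3) continuous_on_powr_pos[OF c(1)]]
    by (simp add: powr_powr)
qed

lemma bop_inv_eq_powr: "posdef (A :: 'a::chilbert_space bop) \<Longrightarrow> bop_inv A = bop_powr A (- 1)"
  by (intro bop_inv_eqI) (metis bop_powr_minus bop_powr_one)+

text \<open>The function \<open>(t, s) \<mapsto> t\<^sup>s\<close> is uniformly continuous on a compact rectangle, so \<open>t\<^sup>s\<close> converges
  uniformly in \<open>t\<close>.\<close>

lemma tendsto_bop_powr:
  assumes A: "posdef (A :: 'a::chilbert_space bop)" and s: "s \<longlonglongrightarrow> l" "\<And>n. s n \<in> {0..1}" "l \<in> {0..1}"
  shows "(\<lambda>n::nat. bop_powr A (s n)) \<longlonglongrightarrow> bop_powr A l"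
proof (rule tendstoI)
  fix e :: real assume "e > 0"
  obtain a b where a: "0 < a" and I: "spectral_interval A a b" using posdef_interval A by blast
  interpret spectral_interval A a b by (rule I)
  have "continuous_on ({a..b} \<times> {0..1}) (\<lambda>x. fst x powr snd x)"
    using a by (intro continuous_intros) auto
  then have "uniformly_continuous_on ({a..b} \<times> {0..1}) (\<lambda>x. fst x powr snd x)"
    by (intro compact_uniformly_continuous compact_Times) auto
  moreover have "e / 2 > 0" using \<open>e > 0\<close> by simp
  ultimately obtain d where d: "d > 0" "\<And>x y. x \<in> {a..b} \<times> {0..1} \<Longrightarrow> y \<in> {a..b} \<times> {0..1} \<Longrightarrow> dist y x < d
      \<Longrightarrow> dist (fst y powr snd y) (fst x powr snd x) < e / 2"
    by (rule uniformly_continuous_onE) blast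
  have "\<forall>\<^sub>F n in sequentially. dist (s n) l < d"
    using s(1) d(1) by (rule tendstoD)
  then show "\<forall>\<^sub>F n in sequentially. dist (bop_powr A (s n)) (bop_powr A l) < e"
  proof eventually_elim
    case (elim n)
    have "\<bar>t powr s n - t powr l\<bar> \<le> e / 2" if "t \<in> {a..b}" for t
      using d(2)[of "(t, l)" "(t, s n)"] that s(2)[of n] s(3) elim
      by (auto simp: dist_Pair_Pair dist_real_def)
    then have "norm (fun_calc (\<lambda>t. t powr s n - t powr l) A) \<le> e / 2"
      using \<open>e > 0\<close> by (intro calc_norm_le continuous_on_diff continuous_on_powr_pos a) auto
    then show ?case
      using \<open>e > 0\<close> by (simp add: calc_diff continuous_on_powr_pos[OF a] bop_powr_def dist_norm)
  qed
qed

section \<open>Positive linear maps\<close>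

locale positive_linear_map =
  fixes \<Phi> :: "'a::chilbert_space bop \<Rightarrow> 'b::chilbert_space bop"
  assumes add: "\<Phi> (X + Y) = \<Phi> X + \<Phi> Y"
    and scaleR: "\<Phi> (c *\<^sub>R X) = c *\<^sub>R \<Phi> X"
    and positive: "0 \<le> X \<Longrightarrow> 0 \<le> \<Phi> X"
begin

lemma zero: "\<Phi> 0 = 0"
  using scaleR[of 0 0] by simp

lemma diff: "\<Phi> (X - Y) = \<Phi> X - \<Phi> Y"
  using add[of "X - Y" Y] by simp

lemma mono: "X \<le> Y \<Longrightarrow> \<Phi> X \<le> \<Phi> Y"
  using positive[of "Y - X"] by (simp add: diff)

lemma sum: "\<Phi> (\<Sum>i\<in>I. X i) = (\<Sum>i\<in>I. \<Phi> (X i))"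
  by (induction I rule: infinite_finite_induct) (auto simp: zero add)

lemma selfadjoint_map:
  assumes "selfadjoint X"
  shows "selfadjoint (\<Phi> X)"
proof -
  have "- (norm X *\<^sub>R 1) \<le> X" using norm_le_iff[OF assms, of "norm X"] by simp
  then have "0 \<le> X + norm X *\<^sub>R 1" using minus_le_iff_add by blast
  then have "selfadjoint (\<Phi> (X + norm X *\<^sub>R 1))" by (intro selfadjoint_nonneg positive)
  moreover have "selfadjoint (\<Phi> (norm X *\<^sub>R 1))" by (intro selfadjoint_nonneg positive scaleR_one_nonneg) simp
  ultimately have "selfadjoint (\<Phi> (X + norm X *\<^sub>R 1) - \<Phi> (norm X *\<^sub>R 1))" by (rule selfadjoint_diff)
  then show ?thesis by (simp add: diff[symmetric])
qed

text \<open>On self-adjoint operators a positive map is bounded, since \<open>X\<close> lies between multiples of \<open>1\<close>.\<close>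

lemma norm_map_le:
  assumes "selfadjoint X"
  shows "norm (\<Phi> X) \<le> norm X * norm (\<Phi> 1)"
proof -
  have P1: "0 \<le> \<Phi> 1" using positive scaleR_one_nonneg[of 1] by simp
  have "\<Phi> 1 \<le> norm (\<Phi> 1) *\<^sub>R 1" by (intro selfadjoint_le_norm selfadjoint_map) simp
  then have 1: "norm X *\<^sub>R \<Phi> 1 \<le> (norm X * norm (\<Phi> 1)) *\<^sub>R 1"
    by (metis norm_ge_zero scaleR_left_mono scaleR_scaleR)
  have "- (norm X *\<^sub>R 1) \<le> X" "X \<le> norm X *\<^sub>R 1"
    using norm_le_iff[OF assms, of "norm X"] by simp_all
  then have "\<Phi> ((- norm X) *\<^sub>R 1) \<le> \<Phi> X" "\<Phi> X \<le> \<Phi> (norm X *\<^sub>R 1)"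
    by (intro mono; simp)+
  with 1 have "- ((norm X * norm (\<Phi> 1)) *\<^sub>R 1) \<le> \<Phi> X" "\<Phi> X \<le> (norm X * norm (\<Phi> 1)) *\<^sub>R 1"
    unfolding scaleR by (auto simp: minus_le_iff intro: order_trans)
  then show ?thesis using norm_le_iff[OF selfadjoint_map[OF assms]] by simp
qed

lemma tendsto_map:
  assumes "X \<longlonglongrightarrow> Y" "\<And>n. selfadjoint (X n)"
  shows "(\<lambda>n. \<Phi> (X n)) \<longlonglongrightarrow> \<Phi> Y"
proof -
  have sY: "selfadjoint Y" by (rule selfadjoint_limit[OF assms])
  have "(\<lambda>n. norm (X n - Y) * norm (\<Phi> 1)) \<longlonglongrightarrow> 0"
    using tendsto_mult_left_zero[OF tendsto_norm_zero[OF LIM_zero[OF assms(1)]]] .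
  then have "(\<lambda>n. \<Phi> (X n) - \<Phi> Y) \<longlonglongrightarrow> 0"
    by (rule Lim_null_comparison[rotated])
      (use sY assms(2) norm_map_le diff in \<open>auto simp: diff[symmetric]\<close>)
  then show ?thesis by (rule LIM_zero_cancel)
qed

text \<open>A positive map need not be 2-positive, but it behaves as if it were on the commutative algebra
  generated by one operator \<open>T\<close>: the operator matrix with rows \<open>\<Phi>(f\<^sup>2(T)), \<Phi>((fg)(T))\<close> and
  \<open>\<Phi>((fg)(T)), \<Phi>(g\<^sup>2(T))\<close> is positive. For the Bernstein approximations the form is
  a sum of values of the positive operators \<open>\<Phi>(b\<^sub>k(T))\<close> at the vectors \<open>f(t\<^sub>k) x + g(t\<^sub>k) y\<close>.\<close>

lemma calc_Schwarz:
  assumes I: "spectral_interval T a b" and f: "continuous_on {a..b} f" and g: "continuous_on {a..b} g"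
  shows "0 \<le> rin (\<Phi> (fun_calc (\<lambda>t. f t * f t) T) \<cdot> x) x + 2 * rin (\<Phi> (fun_calc (\<lambda>t. f t * g t) T) \<cdot> x) y
    + rin (\<Phi> (fun_calc (\<lambda>t. g t * g t) T) \<cdot> y) y"
proof -
  interpret spectral_interval T a b by (rule I)
  define E where "E n k = \<Phi> (poly_bop (bernstein_poly a b n k) T)" for n k
  define t where "t = bernstein_node a b"
  have lim: "(\<lambda>n. rin ((\<Sum>k\<le>n. h (t n k) *\<^sub>R E n k) \<cdot> u) v) \<longlonglongrightarrow> rin (\<Phi> (fun_calc h T) \<cdot> u) v"
    if h: "continuous_on {a..b} h" for h u v
  proof -
    have "(\<lambda>n. \<Phi> (poly_bop (bernstein_approx h a b n) T)) \<longlonglongrightarrow> \<Phi> (fun_calc h T)"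
      by (intro tendsto_map calc_bernstein h selfadjoint_poly_bop selfadjoint_op)
    then show ?thesis
      by (intro tendsto_rin_bop)
        (simp add: bernstein_approx_def poly_bop_sum poly_bop_smult sum scaleR E_def t_def)
  qed
  have E: "0 \<le> E n k" for n k
    unfolding E_def by (intro positive poly_nonneg bernstein_poly_nonneg a_less_b)
  have Esym: "rin (E n k \<cdot> x) y = rin (E n k \<cdot> y) x" for n k x y
    using selfadjointD[OF selfadjoint_nonneg[OF E[of n k]], of x y] rin_commute by metis
  let ?S = "\<lambda>h n. \<Sum>k\<le>n. h (t n k) *\<^sub>R E n k"
  have "0 \<le> rin (?S (\<lambda>s. f s * f s) n \<cdot> x) x + 2 * rin (?S (\<lambda>s. f s * g s) n \<cdot> x) y
      + rin (?S (\<lambda>s. g s * g s) n \<cdot> y) y" for n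
  proof -
    have "0 \<le> (\<Sum>k\<le>n. rin (E n k \<cdot> (f (t n k) *\<^sub>R x + g (t n k) *\<^sub>R y)) (f (t n k) *\<^sub>R x + g (t n k) *\<^sub>R y))"
      by (intro sum_nonneg bop_nonnegD E)
    also have "\<dots> = (\<Sum>k\<le>n. (f (t n k) * f (t n k)) * rin (E n k \<cdot> x) x
        + 2 * ((f (t n k) * g (t n k)) * rin (E n k \<cdot> x) y) + (g (t n k) * g (t n k)) * rin (E n k \<cdot> y) y)"
      by (intro sum.cong refl)
        (simp add: bop_apply_add bop_apply_scaleR rin.add_left rin.add_right rin.scaleR_left
          rin.scaleR_right Esym[of _ _ y x] algebra_simps)
    also have "\<dots> = rin (?S (\<lambda>s. f s * f s) n \<cdot> x) x + 2 * rin (?S (\<lambda>s. f s * g s) n \<cdot> x) y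
      + rin (?S (\<lambda>s. g s * g s) n \<cdot> y) y"
      by (simp add: bop_sum rin.sum_left rin.scaleR_left sum.distrib sum_distrib_left)
    finally show ?thesis .
  qed
  moreover have "(\<lambda>n. rin (?S (\<lambda>s. f s * f s) n \<cdot> x) x + 2 * rin (?S (\<lambda>s. f s * g s) n \<cdot> x) y
      + rin (?S (\<lambda>s. g s * g s) n \<cdot> y) y) \<longlonglongrightarrow> rin (\<Phi> (fun_calc (\<lambda>t. f t * f t) T) \<cdot> x) x
      + 2 * rin (\<Phi> (fun_calc (\<lambda>t. f t * g t) T) \<cdot> x) y + rin (\<Phi> (fun_calc (\<lambda>t. g t * g t) T) \<cdot> y) y"
    by (intro tendsto_add tendsto_mult_left lim continuous_on_mult f g)
  ultimately show ?thesis by (meson LIMSEQ_le_const)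
qed

lemma powr_Schwarz:
  assumes A: "posdef A"
  shows "0 \<le> rin (\<Phi> (bop_powr A s) \<cdot> x) x + 2 * rin (\<Phi> (bop_powr A ((s + t) / 2)) \<cdot> x) y
    + rin (\<Phi> (bop_powr A t) \<cdot> y) y"
proof -
  obtain a b where a: "0 < a" and I: "spectral_interval A a b" using posdef_interval A by blast
  note c = continuous_on_powr_pos[OF a]
  show ?thesis
    using calc_Schwarz[OF I c[of _ "s / 2"] c[of _ "t / 2"], of x y]
    by (simp add: powr_add[symmetric] bop_powr_def add_divide_distrib)
qed

end

text \<open>Similarity does not preserve norms, but \<open>K Y L\<close> has the approximate eigenvector \<open>K u\<close> whenever \<open>Y\<close>
  has \<open>u\<close>, for the same approximate eigenvalue. So the numerical range of \<open>K Y L\<close> bounds the spectrum of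
  \<open>Y\<close>, hence \<open>Y\<close> itself.\<close>

lemma le_if_similar_form_le:
  assumes Y: "selfadjoint Y" and KL: "L * K = 1"
    and le: "\<And>a. rin ((K * Y * L) \<cdot> a) a \<le> g * (norm a)\<^sup>2"
  shows "Y \<le> g *\<^sub>R 1"
proof (rule ccontr)
  assume "\<not> Y \<le> g *\<^sub>R 1"
  then obtain \<beta> where b: "\<beta> > g" "\<not> bounded_below (Y - \<beta> *\<^sub>R 1)"
    using approximate_eigenvalue_above[OF Y] by blast
  define C where "C = norm L * norm K + 1"
  have C: "C > 0" by (simp add: C_def add_nonneg_pos)
  then obtain u where u: "norm u = 1" "norm ((Y - \<beta> *\<^sub>R 1) \<cdot> u) < (\<beta> - g) / C"
    using approx_kernel[OF b(2), of "(\<beta> - g) / C"] b by auto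
  define e where "e = Y \<cdot> u - \<beta> *\<^sub>R u"
  define a where "a = K \<cdot> u"
  have La: "L \<cdot> a = u" using KL unfolding a_def by (metis bop_one bop_times)
  have "(K * Y * L) \<cdot> a = \<beta> *\<^sub>R a + K \<cdot> e"
    by (simp add: La e_def bop_apply_diff bop_apply_scaleR) (simp add: a_def)
  then have "\<beta> * (norm a)\<^sup>2 + rin (K \<cdot> e) a \<le> g * (norm a)\<^sup>2"
    using le[of a] by (simp add: rin.add_left rin.scaleR_left rin_self)
  then have "(\<beta> - g) * (norm a)\<^sup>2 \<le> norm (K \<cdot> e) * norm a"
    using rin_Cauchy_Schwarz[of "K \<cdot> e" a] by (simp add: algebra_simps)
  also have "\<dots> \<le> (norm K * norm e) * norm a"
    by (intro mult_right_mono norm_bop_apply) simp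
  finally have "((\<beta> - g) * norm a) * norm a \<le> (norm K * norm e) * norm a"
    by (simp add: power2_eq_square mult.assoc)
  moreover have na: "1 \<le> norm L * norm a" using norm_bop_apply[of L a] La u by simp
  then have "norm a > 0" by (metis mult_zero_right norm_ge_zero not_one_le_zero order_le_less)
  ultimately have 1: "(\<beta> - g) * norm a \<le> norm K * norm e" by simp
  have "\<beta> - g \<le> (\<beta> - g) * (norm L * norm a)" using na b by simp
  also have "\<dots> \<le> norm L * (norm K * norm e)"
    using mult_left_mono[OF 1, of "norm L"] by (simp add: ac_simps)
  also have "\<dots> \<le> C * norm e" by (simp add: C_def algebra_simps)
  also have "\<dots> < \<beta> - g"
    using u(2) C by (simp add: e_def field_simps)
  finally show False by simp
qed

text \<open>The geometric mean of two positive operators is the largest \<open>X\<close> that makes the operator matrix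
  with these diagonal entries and off-diagonal entries \<open>X\<close> positive; here the diagonal entries are
  two powers of \<open>D\<close>. Substituting \<open>D\<^sup>-\<^sup>s\<^sup>/\<^sup>2 a\<close> and \<open>- D\<^sup>-\<^sup>t\<^sup>/\<^sup>2 a\<close> into the form bounds the numerical range of
  \<open>D\<^sup>-\<^sup>t\<^sup>/\<^sup>2 X D\<^sup>-\<^sup>s\<^sup>/\<^sup>2\<close>, which is similar to the self-adjoint operator \<open>Y = D\<^sup>-\<^sup>c X D\<^sup>-\<^sup>c\<close> with
  \<open>c = (s + t)/4\<close>.\<close>

lemma le_powr_midpoint:
  assumes D: "posdef (D :: 'a::chilbert_space bop)" and X: "selfadjoint X"
    and form: "\<And>x y. 0 \<le> rin (bop_powr D s \<cdot> x) x + 2 * rin (X \<cdot> x) y + rin (bop_powr D t \<cdot> y) y"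
  shows "X \<le> bop_powr D ((s + t) / 2)"
proof -
  let ?p = "bop_powr D"
  define c where "c = (s + t) / 4"
  define k where "k = (s - t) / 4"
  define Y where "Y = ?p (- c) * X * ?p (- c)"
  have p3: "?p u * (?p v * Z) = ?p (u + v) * Z" for u v Z
    by (simp add: mult.assoc[symmetric] bop_powr_add[OF D])
  have "Y \<le> 1 *\<^sub>R 1"
  proof (rule le_if_similar_form_le)
    show "selfadjoint Y" unfolding Y_def by (intro selfadjoint_sandwich selfadjoint_bop_powr D X)
    show "?p (- k) * ?p k = 1" by (rule bop_powr_minus[OF D])
    fix a
    have "?p k * Y * ?p (- k) = ?p (- t / 2) * X * ?p (- s / 2)"
    proof -
      have "k - c = - t / 2" "- c - k = - s / 2" by (simp_all add: k_def c_def field_simps)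
      then show ?thesis
        using p3[of k "- c"] by (simp add: Y_def mult.assoc bop_powr_add[OF D])
    qed
    then have 1: "rin ((?p k * Y * ?p (- k)) \<cdot> a) a = rin (X \<cdot> ?p (- s / 2) \<cdot> a) (?p (- t / 2) \<cdot> a)"
      using selfadjointD[OF selfadjoint_bop_powr[OF D]] by simp
    have 2: "rin (?p u \<cdot> ?p (- u / 2) \<cdot> a) (?p (- u / 2) \<cdot> a) = (norm a)\<^sup>2" for u
    proof -
      have "rin (?p u \<cdot> ?p (- u / 2) \<cdot> a) (?p (- u / 2) \<cdot> a) = rin ((?p (- u / 2) * ?p u * ?p (- u / 2)) \<cdot> a) a"
        by (simp add: selfadjointD[OF selfadjoint_bop_powr[OF D]])
      also have "?p (- u / 2) * ?p u * ?p (- u / 2) = 1"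
        by (simp add: bop_powr_add[OF D] bop_powr_zero[OF D])
      finally show ?thesis by (simp add: rin_self)
    qed
    have "0 \<le> (norm a)\<^sup>2 - 2 * rin (X \<cdot> ?p (- s / 2) \<cdot> a) (?p (- t / 2) \<cdot> a) + (norm a)\<^sup>2"
      using form[of "?p (- s / 2) \<cdot> a" "- (?p (- t / 2) \<cdot> a)"] 2[of s] 2[of t]
      by (simp add: rin.minus_left rin.minus_right bop_apply_minus)
    then show "rin ((?p k * Y * ?p (- k)) \<cdot> a) a \<le> 1 * (norm a)\<^sup>2"
      unfolding 1 by simp
  qed
  from sandwich_mono[OF selfadjoint_bop_powr[OF D, of c] this]
  have "?p c * Y * ?p c \<le> ?p c * ?p c" by simp
  moreover have "?p c * Y * ?p c = X"
    by (simp add: Y_def mult.assoc bop_powr_minus[OF D] p3 bop_powr_zero[OF D])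
  moreover have "?p c * ?p c = ?p ((s + t) / 2)"
    by (simp add: bop_powr_add[OF D] c_def)
  ultimately show ?thesis by simp
qed

locale unital_positive_map = positive_linear_map +
  assumes unital: "\<Phi> 1 = 1"
begin

lemma posdef_map: "posdef A \<Longrightarrow> posdef (\<Phi> A)"
  unfolding posdef_def using mono scaleR unital by metis

text \<open>By the Schwarz inequality the matrix with diagonal \<open>\<Phi>(A\<^sup>s), \<Phi>(A\<^sup>t)\<close> is positive; it stays
  positive when the diagonal is increased to \<open>\<Phi>(A)\<^sup>s, \<Phi>(A)\<^sup>t\<close>.\<close>

lemma map_powr_midpoint:
  assumes A: "posdef A" and s: "\<Phi> (bop_powr A s) \<le> bop_powr (\<Phi> A) s"
    and t: "\<Phi> (bop_powr A t) \<le> bop_powr (\<Phi> A) t"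
  shows "\<Phi> (bop_powr A ((s + t) / 2)) \<le> bop_powr (\<Phi> A) ((s + t) / 2)"
proof (rule le_powr_midpoint[OF posdef_map[OF A]])
  show "selfadjoint (\<Phi> (bop_powr A ((s + t) / 2)))" by (intro selfadjoint_map selfadjoint_bop_powr A)
  show "0 \<le> rin (bop_powr (\<Phi> A) s \<cdot> x) x + 2 * rin (\<Phi> (bop_powr A ((s + t) / 2)) \<cdot> x) y
      + rin (bop_powr (\<Phi> A) t \<cdot> y) y" for x y
    using powr_Schwarz[OF A, of s x t y] bop_leD[OF s, of x] bop_leD[OF t, of y] by linarith
qed

lemma map_powr_dyadic:
  fixes k :: nat
  assumes A: "posdef A" and "k \<le> 2 ^ n"
  shows "\<Phi> (bop_powr A (k / 2 ^ n)) \<le> bop_powr (\<Phi> A) (k / 2 ^ n)"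
  using assms(2)
proof (induction n arbitrary: k)
  case 0
  then have "k = 0 \<or> k = 1" by auto
  then show ?case
    using A by (auto simp: bop_powr_zero bop_powr_one posdef_map unital)
next
  case (Suc n)
  show ?case
  proof (cases "even k")
    case True
    then obtain j where j: "k = 2 * j" by blast
    then show ?thesis using Suc.IH[of j] Suc.prems by simp
  next
    case False
    then obtain j where j: "k = 2 * j + 1" by (blast elim: oddE)
    then have "Suc j \<le> 2 ^ n" using Suc.prems by simp
    then have "j \<le> 2 ^ n" by simp
    have eq: "(real j / 2 ^ n + real (Suc j) / 2 ^ n) / 2 = real k / 2 ^ Suc n"
      by (simp add: j add_divide_distrib)
    show ?thesis
      using map_powr_midpoint[OF A Suc.IH[OF \<open>j \<le> 2 ^ n\<close>] Suc.IH[OF \<open>Suc j \<le> 2 ^ n\<close>]]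
      unfolding eq .
  qed
qed

text \<open>Jensen's inequality for the operator concave function \<open>t\<^sup>s\<close>. The exponents for which it holds contain
  \<open>0\<close> and \<open>1\<close>, are closed under midpoints, and form a closed set.\<close>

lemma map_powr_le:
  assumes A: "posdef A" and s: "0 \<le> s" "s \<le> 1"
  shows "\<Phi> (bop_powr A s) \<le> bop_powr (\<Phi> A) s"
proof -
  define k where "k n = nat \<lfloor>s * 2 ^ n\<rfloor>" for n
  define q where "q n = real (k n) / 2 ^ n" for n
  have k0: "real (k n) = of_int \<lfloor>s * 2 ^ n\<rfloor>" for n using s by (simp add: k_def)
  have kle: "real (k n) \<le> s * 2 ^ n" for n unfolding k0 by linarith
  have kge: "s * 2 ^ n - 1 \<le> real (k n)" for n unfolding k0 by linarith
  have "s * 2 ^ n \<le> 2 ^ n" for n using s by simp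
  with kle have "real (k n) \<le> real (2 ^ n)" for n by (metis of_nat_numeral of_nat_power order_trans)
  then have kn: "k n \<le> 2 ^ n" for n using of_nat_le_iff by blast
  have q1: "q n \<le> s" for n using kle[of n] by (simp add: q_def divide_le_eq)
  have q2: "s - 1 / 2 ^ n \<le> q n" for n 
    using divide_right_mono[OF kge[of n], of "2 ^ n"] by (simp add: q_def diff_divide_distrib)
  have "q \<longlonglongrightarrow> s"
  proof (rule tendsto_sandwich[OF _ _ _ tendsto_const])
    have "(\<lambda>n. s - (1 / 2) ^ n) \<longlonglongrightarrow> s - 0"
      by (intro tendsto_intros LIMSEQ_power_zero) auto
    then show "(\<lambda>n. s - 1 / 2 ^ n) \<longlonglongrightarrow> s" by (simp add: power_one_over)
  qed (use q1 q2 in auto)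
  have q01: "q n \<in> {0..1}" for n
    using kn[of n] of_nat_le_iff[of "k n" "2 ^ n", where 'a = real] by (simp add: q_def)
  have "(\<lambda>n. \<Phi> (bop_powr A (q n))) \<longlonglongrightarrow> \<Phi> (bop_powr A s)"
    by (intro tendsto_map tendsto_bop_powr selfadjoint_bop_powr A) (use \<open>q \<longlonglongrightarrow> s\<close> q01 s in auto)
  moreover have "(\<lambda>n. bop_powr (\<Phi> A) (q n)) \<longlonglongrightarrow> bop_powr (\<Phi> A) s"
    by (intro tendsto_bop_powr posdef_map A) (use \<open>q \<longlonglongrightarrow> s\<close> q01 s in auto)
  ultimately show ?thesis
    by (rule le_limit) (use map_powr_dyadic[OF A kn] in \<open>simp add: q_def\<close>)
qed

end

section \<open>Squares from a bound on a sum\<close>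

text \<open>With \<open>z = T b + S a\<close>, polarization bounds the left-hand side by the form of \<open>S + T\<close> at \<open>z\<close>, and this is at
  most \<open>l\<close> times the squared norm of \<open>z\<close>. That norm is estimated by testing the forms of \<open>S\<close> and \<open>T\<close> with
  \<open>l a - z\<close> and \<open>l b - z\<close>.\<close>

lemma form_off_diagonal_le:
  assumes S: "0 \<le> S" and T: "0 \<le> T" and le: "S + T \<le> l *\<^sub>R 1"
  shows "4 * rin ((S + T) \<cdot> (T \<cdot> b)) (S \<cdot> a) \<le> l\<^sup>2 * (rin (S \<cdot> a) a + rin (T \<cdot> b) b)"
proof -
  have *: "2 * l * rin (P \<cdot> c) z \<le> l\<^sup>2 * rin (P \<cdot> c) c + rin (P \<cdot> z) z" if "0 \<le> P" for P :: "'a bop" and c z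
  proof -
    have "0 \<le> rin (P \<cdot> (l *\<^sub>R c - z)) (l *\<^sub>R c - z)"
      using that by (rule bop_nonnegD)
    moreover have "rin (P \<cdot> z) c = rin (P \<cdot> c) z"
      using selfadjointD[OF selfadjoint_nonneg[OF that]] rin_commute by metis
    ultimately show ?thesis
      by (simp add: bop_apply_diff bop_apply_scaleR rin.diff_left rin.diff_right rin.scaleR_left
          rin.scaleR_right power2_eq_square algebra_simps)
  qed
  define x where "x = T \<cdot> b"
  define y where "y = S \<cdot> a"
  define z where "z = x + y"
  have lez: "rin ((S + T) \<cdot> z) z \<le> l * (norm z)\<^sup>2"
    using bop_leD[OF le, of z] by (simp add: rin.scaleR_left rin_self)
  have "2 * l * (norm z)\<^sup>2 = 2 * l * rin y z + 2 * l * rin x z"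
    by (simp add: z_def rin_self[symmetric] rin.add_left algebra_simps)
  also have "\<dots> \<le> l\<^sup>2 * (rin (S \<cdot> a) a + rin (T \<cdot> b) b) + rin ((S + T) \<cdot> z) z"
    using *[OF S, of a z] *[OF T, of b z] by (simp add: x_def y_def rin.add_left algebra_simps)
  finally have 1: "l * (norm z)\<^sup>2 \<le> l\<^sup>2 * (rin (S \<cdot> a) a + rin (T \<cdot> b) b)"
    using lez by linarith
  have "4 * rin ((S + T) \<cdot> x) y = rin ((S + T) \<cdot> z) z - rin ((S + T) \<cdot> (x - y)) (x - y)"
    unfolding z_def using S T by (intro polarization selfadjoint_add selfadjoint_nonneg)
  also have "\<dots> \<le> rin ((S + T) \<cdot> z) z"
    using bop_nonnegD[OF add_nonneg_nonneg[OF S T]] by simp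
  finally show ?thesis using lez 1 unfolding x_def y_def by linarith
qed

text \<open>The Bhatia-Kittaneh inequality: the norm of \<open>S T\<close> is at most \<open>l\<^sup>2/4\<close>. Suppose that \<open>x\<close> were an
  eigenvector of \<open>T S\<^sup>2 T\<close> for an eigenvalue \<open>N\<^sup>2\<close>. Then \<open>y = S T x / N\<close> satisfies \<open>T S y = N x\<close>, and with
  \<open>y = S a\<close> and \<open>x = T b\<close> the form of \<open>S + T\<close> at \<open>x, y\<close> is \<open>N\<close> times \<open>Q = \<langle>S a, a\<rangle> + \<langle>T b, b\<rangle>\<close>. The
  preceding lemma gives \<open>4 N Q \<le> l\<^sup>2 Q\<close>. With an approximate eigenvector there is an error term, which
  is harmless because \<open>Q\<close> is bounded away from \<open>0\<close>.\<close>

lemma square_compression_le: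
  fixes S T R :: "'a::complex_inner bop"
  assumes S: "0 \<le> S" and T: "0 \<le> T" and RT: "R * T = 1" "T * R = 1"
    and le: "S + T \<le> l *\<^sub>R 1"
  shows "T * (S * S) * T \<le> (l\<^sup>2 / 4)\<^sup>2 *\<^sub>R 1"
proof (rule ccontr)
  let ?W = "T * (S * S) * T"
  note sS = selfadjoint_nonneg[OF S] and sT = selfadjoint_nonneg[OF T]
  have sW: "selfadjoint ?W" using sS sT by (intro selfadjoint_sandwich selfadjoint_square)
  assume "\<not> ?W \<le> (l\<^sup>2 / 4)\<^sup>2 *\<^sub>R 1"
  then obtain \<beta> where b: "\<beta> > (l\<^sup>2 / 4)\<^sup>2" "\<not> bounded_below (?W - \<beta> *\<^sub>R 1)"
    using approximate_eigenvalue_above[OF sW] by blast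
  define N where "N = sqrt \<beta>"
  have "\<beta> > 0" using b(1) by (meson le_less_trans zero_le_power2)
  then have N: "N > 0" "N * N = \<beta>" by (simp_all add: N_def)
  have Nl: "4 * N > l\<^sup>2"
    using real_less_rsqrt[OF b(1)] by (simp add: N_def)
  \<comment> \<open>this constant collects the bound on the error term and the lower bound on \<open>Q\<close>\<close>
  define c where "c = 4 * (norm R + 1) * (norm T + 1)"
  have c: "c > 0" by (simp add: c_def add_nonneg_pos)
  have "(4 * N - l\<^sup>2) * N / c > 0" using N Nl c by simp
  then obtain x where x: "norm x = 1" "norm ((?W - \<beta> *\<^sub>R 1) \<cdot> x) < (4 * N - l\<^sup>2) * N / c"
    using approx_kernel[OF b(2)] by blast
  define e where "e = ?W \<cdot> x - \<beta> *\<^sub>R x"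
  define a where "a = (1 / N) *\<^sub>R (T \<cdot> x)"
  define b where "b = R \<cdot> x"
  define y where "y = S \<cdot> a"
  define Q where "Q = rin (S \<cdot> a) a + rin (T \<cdot> b) b"
  have Tb: "T \<cdot> b = x" using RT(2) unfolding b_def by (metis bop_one bop_times)
  have RTv: "R \<cdot> T \<cdot> v = v" for v using RT(1) by (metis bop_one bop_times)
  have "T \<cdot> S \<cdot> y = (1 / N) *\<^sub>R (?W \<cdot> x)"
    by (simp add: y_def a_def bop_apply_scaleR)
  also have "\<dots> = N *\<^sub>R x + (1 / N) *\<^sub>R e"
    using N by (simp add: e_def scaleR_diff_right flip: N(2))
  finally have "R \<cdot> T \<cdot> S \<cdot> y = R \<cdot> (N *\<^sub>R x + (1 / N) *\<^sub>R e)" by simp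
  then have Sy: "S \<cdot> y = N *\<^sub>R b + (1 / N) *\<^sub>R (R \<cdot> e)"
    unfolding RTv by (simp add: b_def bop_apply_add bop_apply_scaleR)
  have 1: "rin (T \<cdot> x) y = N * rin (S \<cdot> a) a"
  proof -
    have "T \<cdot> x = N *\<^sub>R a" using N by (simp add: a_def)
    then show ?thesis by (simp add: rin.scaleR_left y_def rin_commute[of a])
  qed
  have 2: "rin (S \<cdot> x) y = N * rin (T \<cdot> b) b + rin x (R \<cdot> e) / N"
    by (simp add: selfadjointD[OF sS] Sy rin.add_right rin.scaleR_right Tb)
  have "4 * rin ((S + T) \<cdot> x) y \<le> l\<^sup>2 * Q"
    using form_off_diagonal_le[OF S T le, of b a] by (simp add: Tb y_def Q_def)
  then have "4 * (N * Q + rin x (R \<cdot> e) / N) \<le> l\<^sup>2 * Q"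
    by (simp add: rin.add_left 1 2 Q_def algebra_simps)
  moreover have "- (rin x (R \<cdot> e) / N) \<le> norm R * norm e / N"
  proof -
    have "- rin x (R \<cdot> e) \<le> norm x * norm (R \<cdot> e)"
      using rin_Cauchy_Schwarz[of x "R \<cdot> e"] by linarith
    also have "\<dots> \<le> norm R * norm e" using x norm_bop_apply by simp
    finally have "- rin x (R \<cdot> e) / N \<le> norm R * norm e / N"
      using N by (intro divide_right_mono) auto
    then show ?thesis by simp
  qed
  ultimately have 3: "(4 * N - l\<^sup>2) * Q \<le> 4 * (norm R * norm e / N)"
    by (simp add: left_diff_distrib)
  have "1 \<le> (norm T + 1) * rin (T \<cdot> b) b"
    using norm_square_le_form[OF T, of b] x by (simp add: Tb)
  also have "\<dots> \<le> (norm T + 1) * Q"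
    using bop_nonnegD[OF S, of a] by (intro mult_left_mono) (auto simp: Q_def)
  finally have "4 * N - l\<^sup>2 \<le> (norm T + 1) * ((4 * N - l\<^sup>2) * Q)"
    using Nl mult_left_mono[of 1 "(norm T + 1) * Q" "4 * N - l\<^sup>2"] by (simp add: ac_simps)
  also have "\<dots> \<le> (norm T + 1) * (4 * (norm R * norm e / N))"
    using 3 by (intro mult_left_mono) auto
  also have "\<dots> \<le> (norm T + 1) * (4 * ((norm R + 1) * norm e / N))"
    using N by (intro mult_left_mono divide_right_mono mult_right_mono) auto
  also have "\<dots> = c * norm e / N" by (simp add: c_def)
  also have "\<dots> < 4 * N - l\<^sup>2"
    using x(2) c N by (simp add: e_def field_simps)
  finally show False by simp
qed

lemma square_le_if_sum_le:
  assumes S: "0 \<le> S" and Z: "selfadjoint Z" and Z': "0 \<le> Z'" "Z * Z' = 1" "Z' * Z = 1"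
    and k: "k > 0" and le: "S + k *\<^sub>R Z' \<le> l *\<^sub>R 1"
  shows "S * S \<le> (l\<^sup>2 / (4 * k))\<^sup>2 *\<^sub>R (Z * Z)"
proof -
  let ?T = "k *\<^sub>R Z'"
  have T: "0 \<le> ?T" using k Z'(1) by (simp add: scaleR_nonneg_nonneg)
  have "?T * (S * S) * ?T \<le> (l\<^sup>2 / 4)\<^sup>2 *\<^sub>R 1"
    by (rule square_compression_le[OF S T _ _ le, of "(1 / k) *\<^sub>R Z"]) (use k Z' in auto)
  from sandwich_mono[OF Z this]
  have "Z * (?T * (S * S) * ?T) * Z \<le> (l\<^sup>2 / 4)\<^sup>2 *\<^sub>R (Z * Z)" by simp
  moreover have "Z * (?T * (S * S) * ?T) * Z = k\<^sup>2 *\<^sub>R (S * S)"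
  proof -
    have "Z * (?T * (S * S) * ?T) * Z = k\<^sup>2 *\<^sub>R ((Z * Z') * (S * S) * (Z' * Z))"
      by (simp add: power2_eq_square mult.assoc)
    then show ?thesis by (simp add: Z')
  qed
  ultimately have "(1 / k\<^sup>2) *\<^sub>R (k\<^sup>2 *\<^sub>R (S * S)) \<le> (1 / k\<^sup>2) *\<^sub>R ((l\<^sup>2 / 4)\<^sup>2 *\<^sub>R (Z * Z))"
    by (intro scaleR_left_mono) auto
  then show ?thesis using k by (simp add: power_divide power_mult_distrib mult.commute)
qed

section \<open>A refined Young inequality\<close>

lemma kantorovich_pos: "0 < u \<Longrightarrow> 0 < kantorovich u"
  by (simp add: kantorovich_def add_pos_pos zero_less_power)

lemma kantorovich_alt: "0 < u \<Longrightarrow> kantorovich u = (u + 1 / u + 2) / 4"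
  by (simp add: kantorovich_def field_simps power2_eq_square)

lemma kantorovich_inverse: "0 < u \<Longrightarrow> kantorovich (1 / u) = kantorovich u"
  by (simp add: kantorovich_alt)

lemma kantorovich_mono:
  assumes "1 \<le> u" "u \<le> v"
  shows "kantorovich u \<le> kantorovich v"
proof -
  have "1 \<le> u * v" using assms mult_mono[of 1 u 1 v] by simp
  then have "0 \<le> (v - u) * (u * v - 1) / (u * v)" using assms by simp
  also have "\<dots> = (v + 1 / v) - (u + 1 / u)" using assms by (simp add: field_simps)
  finally show ?thesis using assms by (simp add: kantorovich_alt)
qed

lemma powr_Young:
  assumes "0 < x" "0 < y" "0 \<le> \<theta>" "\<theta> \<le> 1"
  shows "x powr (1 - \<theta>) * y powr \<theta> \<le> (1 - \<theta>) * x + \<theta> * (y::real)"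
  using Youngs_inequality_0[of "1 - \<theta>" \<theta> x y] assms by simp

text \<open>The constant is absorbed by \<open>K(u) u = ((1 + u)/2)\<^sup>2\<close>. What remains is the weighted
  arithmetic-geometric mean inequality for \<open>(1 + u)/2\<close> and the endpoint of \<open>{1, u}\<close> nearer to
  \<open>(1 - \<mu>) + \<mu> u\<close>.\<close>

lemma kantorovich_Young:
  assumes u: "0 < u" and \<mu>: "0 \<le> \<mu>" "\<mu> \<le> 1"
  shows "kantorovich u powr min \<mu> (1 - \<mu>) * u powr \<mu> \<le> (1 - \<mu>) + \<mu> * u"
proof -
  have v: "0 < (1 + u) / 2" using u by simp
  have Ku: "kantorovich u * u = ((1 + u) / 2) powr 2"
    using u by (simp add: kantorovich_def power_divide)
  have K: "kantorovich u powr s * u powr s = ((1 + u) / 2) powr (2 * s)" for s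
  proof -
    have "kantorovich u powr s * u powr s = (kantorovich u * u) powr s"
      by (rule powr_mult[symmetric])
    then show ?thesis unfolding Ku powr_powr .
  qed
  show ?thesis
  proof (cases "\<mu> \<le> 1 / 2")
    case True
    then have "min \<mu> (1 - \<mu>) = \<mu>" by simp
    then show ?thesis
      using powr_Young[of 1 "(1 + u) / 2" "2 * \<mu>"] True u \<mu> K[of \<mu>] by (simp add: field_simps)
  next
    case False
    then have "min \<mu> (1 - \<mu>) = 1 - \<mu>" by simp
    moreover have "u powr \<mu> = u powr (1 - \<mu>) * u powr (2 * \<mu> - 1)"
      by (simp add: powr_add[symmetric])
    ultimately have "kantorovich u powr min \<mu> (1 - \<mu>) * u powr \<mu>
        = ((1 + u) / 2) powr (1 - (2 * \<mu> - 1)) * u powr (2 * \<mu> - 1)"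
      using K[of "1 - \<mu>"] by (simp add: algebra_simps)
    also have "\<dots> \<le> (1 - (2 * \<mu> - 1)) * ((1 + u) / 2) + (2 * \<mu> - 1) * u"
      using False u \<mu> by (intro powr_Young) auto
    also have "\<dots> = (1 - \<mu>) + \<mu> * u" by (simp add: field_simps)
    finally show ?thesis .
  qed
qed

text \<open>Moving \<open>r (1 - \<surd>s)\<^sup>2\<close> to the other side leaves \<open>(1 - 2\<nu>) + 2\<nu> \<surd>s\<close> if \<open>\<nu> \<le> 1/2\<close>, and
  \<open>\<surd>s ((2 - 2\<nu>) + (2\<nu> - 1) \<surd>s)\<close> otherwise. So the preceding inequality applies to \<open>\<surd>s\<close> with
  weight \<open>2\<nu>\<close> or \<open>2\<nu> - 1\<close>.\<close>

lemma refined_Young: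
  assumes s: "0 < s" and \<nu>: "0 \<le> \<nu>" "\<nu> \<le> 1"
    and r: "r = min \<nu> (1 - \<nu>)" and r1: "r1 = min (2 * r) (1 - 2 * r)"
  shows "kantorovich (sqrt s) powr r1 * s powr \<nu> + r * (1 - sqrt s)\<^sup>2 \<le> (1 - \<nu>) + \<nu> * s"
proof -
  define u where "u = sqrt s"
  have u: "0 < u" and su: "s = u\<^sup>2" using s by (simp_all add: u_def)
  have sp: "s powr \<nu> = u powr (2 * \<nu>)"
    unfolding su using u by (simp add: powr_powr flip: powr_numeral)
  show ?thesis
  proof (cases "\<nu> \<le> 1 / 2")
    case True
    then have "r = \<nu>" "r1 = min (2 * \<nu>) (1 - 2 * \<nu>)" using r r1 by auto
    then show ?thesis
      using kantorovich_Young[OF u, of "2 * \<nu>"] True \<nu> unfolding sp u_def[symmetric]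
      by (simp add: su power2_eq_square algebra_simps)
  next
    case False
    define \<mu> where "\<mu> = 2 * \<nu> - 1"
    have rr: "r = 1 - \<nu>" using r False by auto
    then have r1': "r1 = min \<mu> (1 - \<mu>)" using r1 by (simp add: \<mu>_def min.commute algebra_simps)
    have "u powr (2 * \<nu>) = u * u powr \<mu>"
      using u by (simp add: \<mu>_def powr_diff)
    then have "kantorovich u powr r1 * u powr (2 * \<nu>) = u * (kantorovich u powr min \<mu> (1 - \<mu>) * u powr \<mu>)"
      by (simp add: r1')
    also have "\<dots> \<le> u * ((1 - \<mu>) + \<mu> * u)"
      using kantorovich_Young[OF u, of \<mu>] False \<nu> u by (intro mult_left_mono) (auto simp: \<mu>_def)
    also have "\<dots> = (1 - \<nu>) + \<nu> * u\<^sup>2 - r * (1 - u)\<^sup>2"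
      by (simp add: \<mu>_def rr power2_eq_square algebra_simps)
    finally show ?thesis unfolding sp u_def[symmetric] by (simp add: su)
  qed
qed

lemma kantorovich_gap:
  assumes h: "1 \<le> h" and t: "0 < t" "t \<le> 1 / h \<or> h \<le> t"
  shows "kantorovich (sqrt h) \<le> kantorovich (sqrt (1 / t))"
  using t(2)
proof
  assume "t \<le> 1 / h"
  then have "h \<le> 1 / t" using h t by (simp add: field_simps)
  then show ?thesis using h by (intro kantorovich_mono) auto
next
  assume "h \<le> t"
  then have "kantorovich (sqrt h) \<le> kantorovich (sqrt t)" using h by (intro kantorovich_mono) auto
  also have "\<dots> = kantorovich (sqrt (1 / t))"
    using kantorovich_inverse[of "sqrt t"] t by (simp add: real_sqrt_divide)
  finally show ?thesis .
qed

text \<open>The refined Young inequality at \<open>1 / t\<close>, expanded into powers of \<open>t\<close> so that the functional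
  calculus applies to it term by term.\<close>

lemma refined_Young_powr:
  assumes h: "1 \<le> h" and t: "0 < t" "t \<le> 1 / h \<or> h \<le> t"
    and \<nu>: "0 \<le> \<nu>" "\<nu> \<le> 1"
    and r: "r = min \<nu> (1 - \<nu>)" and r1: "r1 = min (2 * r) (1 - 2 * r)"
  shows "0 \<le> (1 - \<nu> - r) + (\<nu> - r) * t powr (- 1) + (- (kantorovich (sqrt h) powr r1)) * t powr (- \<nu>)
    + (2 * r) * t powr (- (1 / 2))"
proof -
  have tm: "t powr (- 1) = 1 / t" using t by (simp add: powr_minus_divide)
  have th: "t powr (- (1 / 2)) = sqrt (1 / t)"
    using t by (simp add: powr_minus_divide powr_half_sqrt real_sqrt_divide)
  have tn: "t powr (- \<nu>) = (1 / t) powr \<nu>"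
    using t by (simp add: powr_divide powr_minus_divide)
  have "r \<le> 1 / 2" "0 \<le> r" using r \<nu> by (auto simp: min_def)
  then have "0 \<le> r1" using r1 by simp
  then have "kantorovich (sqrt h) powr r1 \<le> kantorovich (sqrt (1 / t)) powr r1"
    using kantorovich_gap[OF h t] kantorovich_pos[of "sqrt h"] h by (intro powr_mono2) auto
  then have "kantorovich (sqrt h) powr r1 * (1 / t) powr \<nu> \<le> kantorovich (sqrt (1 / t)) powr r1 * (1 / t) powr \<nu>"
    by (intro mult_right_mono) auto
  moreover have "kantorovich (sqrt (1 / t)) powr r1 * (1 / t) powr \<nu> + r * (1 - sqrt (1 / t))\<^sup>2 \<le> (1 - \<nu>) + \<nu> * (1 / t)"
    using t by (intro refined_Young \<nu> r r1) auto
  moreover have "(sqrt (1 / t))\<^sup>2 = 1 / t" using t by simp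
  ultimately show ?thesis unfolding tm th tn by (simp add: power2_diff algebra_simps diff_divide_distrib)
qed

section \<open>Inverses of operator means\<close>

lemma
  assumes "posdef (A :: 'a::chilbert_space bop)"
  shows bop_inv_left: "bop_inv A * A = 1" and bop_inv_right: "A * bop_inv A = 1"
    and posdef_bop_inv: "posdef (bop_inv A)"
  using bop_powr_minus[OF assms, of 1] posdef_bop_powr[OF assms]
  by (simp_all add: bop_inv_eq_powr assms bop_powr_one)

text \<open>The Schwarz inequality for \<open>G\<close> and \<open>G\<^sup>-\<^sup>1\<close>, with off-diagonal entry \<open>\<Phi>(1) = 1\<close>, evaluated at
  \<open>Z\<^sup>-\<^sup>1 u\<close> and \<open>- u\<close>. Enlarging the diagonal entry \<open>\<Phi>(G)\<close> to \<open>Z\<close> keeps the matrix positive.\<close>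

lemma (in unital_positive_map) bop_inv_map_le:
  assumes G: "posdef G" and le: "\<Phi> G \<le> Z"
  shows "bop_inv Z \<le> \<Phi> (bop_inv G)"
proof (rule bop_leI)
  have Z: "posdef Z" using posdef_mono[OF posdef_map[OF G] le] .
  show "selfadjoint (bop_inv Z)" "selfadjoint (\<Phi> (bop_inv G))"
    using posdef_bop_inv[OF Z] posdef_bop_inv[OF G] posdef_map by (auto intro: posdef_selfadjoint)
  fix u
  let ?x = "bop_inv Z \<cdot> u"
  have Zx: "Z \<cdot> ?x = u" using bop_inv_right[OF Z] by (metis bop_one bop_times)
  have "0 \<le> rin (\<Phi> G \<cdot> ?x) ?x + 2 * rin ?x (- u) + rin (\<Phi> (bop_inv G) \<cdot> (- u)) (- u)"
    using powr_Schwarz[OF G, of 1 ?x "- 1" "- u"]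
    by (simp add: bop_powr_one[OF G] bop_powr_zero[OF G] bop_inv_eq_powr[OF G] unital)
  also have "\<dots> \<le> rin (Z \<cdot> ?x) ?x + 2 * rin ?x (- u) + rin (\<Phi> (bop_inv G) \<cdot> (- u)) (- u)"
    using bop_leD[OF le] by simp
  also have "\<dots> = rin (\<Phi> (bop_inv G) \<cdot> u) u - rin ?x u"
    unfolding Zx by (simp add: rin.minus_left rin.minus_right bop_apply_minus rin_commute[of u])
  finally show "rin (bop_inv Z \<cdot> u) u \<le> rin (\<Phi> (bop_inv G) \<cdot> u) u" by simp
qed

lemma posdef_sandwich:
  assumes B: "posdef B" and C: "selfadjoint C" "D * C = 1"
  shows "posdef (C * B * C)"
proof -
  obtain d where d: "d > 0" "d *\<^sub>R 1 \<le> B" using B unfolding posdef_def by blast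
  obtain c where c: "c > 0" "\<And>x. c * norm x \<le> norm (C \<cdot> x)"
    using bounded_below_left_inverse[OF C(2)] unfolding bounded_below_def by blast
  have "(d * c\<^sup>2) *\<^sub>R 1 \<le> C * B * C"
  proof (rule bop_leI)
    fix x
    have "(c * norm x)\<^sup>2 \<le> (norm (C \<cdot> x))\<^sup>2"
      using c by (intro power_mono) auto
    then have "d * (c * norm x)\<^sup>2 \<le> d * (norm (C \<cdot> x))\<^sup>2"
      using d by (intro mult_left_mono) auto
    also have "\<dots> \<le> rin (B \<cdot> C \<cdot> x) (C \<cdot> x)"
      using bop_leD[OF d(2), of "C \<cdot> x"] by (simp add: rin.scaleR_left rin_self)
    also have "\<dots> = rin ((C * B * C) \<cdot> x) x" using rin_sandwich[OF C(1)] by metis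
    finally show "rin (((d * c\<^sup>2) *\<^sub>R 1) \<cdot> x) x \<le> rin ((C * B * C) \<cdot> x) x"
      by (simp add: rin.scaleR_left rin_self power_mult_distrib del: bop_times)
  qed (use C posdef_selfadjoint[OF B] in auto)
  then show ?thesis using d c unfolding posdef_def by (meson mult_pos_pos zero_less_power)
qed

lemma half_powers:
  assumes A: "posdef (A :: 'a::chilbert_space bop)"
  shows "bop_powr A (1 / 2) * bop_powr A (- (1 / 2)) = 1" "bop_powr A (- (1 / 2)) * bop_powr A (1 / 2) = 1"
    "bop_powr A (1 / 2) * (bop_powr A (- (1 / 2)) * Y) = Y" "bop_powr A (- (1 / 2)) * (bop_powr A (1 / 2) * Y) = Y"
  using bop_powr_minus[OF A, of "1 / 2"] by (simp_all flip: mult.assoc)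

lemma sandwich_half_inverse:
  assumes A: "posdef (A :: 'a::chilbert_space bop)"
  shows "bop_powr A (- (1 / 2)) * A * bop_powr A (- (1 / 2)) = 1"
proof -
  have "bop_powr A (- (1 / 2)) * bop_powr A 1 * bop_powr A (- (1 / 2)) = 1"
    by (simp add: bop_powr_add[OF A] bop_powr_zero[OF A])
  then show ?thesis by (simp add: bop_powr_one[OF A])
qed

text \<open>The weighted geometric means of \<open>A\<close> and \<open>B\<close>, and of their inverses, are powers of this one operator,
  multiplied on both sides by a power of \<open>A\<close>. Inequalities between such means thus reduce to scalar ones on its
  spectrum.\<close>

definition relative_bop :: "'a::complex_inner bop \<Rightarrow> 'a bop \<Rightarrow> 'a bop"
  where "relative_bop A B = bop_powr A (- (1 / 2)) * B * bop_powr A (- (1 / 2))"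

lemma gmean_relative:
  "A \<sharp>\<^bsub>\<nu>\<^esub> B = bop_powr A (1 / 2) * bop_powr (relative_bop A B) \<nu> * bop_powr A (1 / 2)"
  by (simp add: gmean_def relative_bop_def)

context
  fixes A B :: "'a::chilbert_space bop"
  assumes A: "posdef A" and B: "posdef B"
begin

lemma posdef_relative: "posdef (relative_bop A B)"
  unfolding relative_bop_def by (intro posdef_sandwich[of _ _ "bop_powr A (1 / 2)"] B selfadjoint_bop_powr A half_powers[OF A])

lemma posdef_gmean: "posdef (A \<sharp>\<^bsub>\<nu>\<^esub> B)"
  unfolding gmean_relative
  by (intro posdef_sandwich[of _ _ "bop_powr A (- (1 / 2))"] posdef_bop_powr posdef_relative selfadjoint_bop_powr A half_powers[OF A])

lemma bop_inv_gmean: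
  "bop_inv (A \<sharp>\<^bsub>\<nu>\<^esub> B) = bop_powr A (- (1 / 2)) * bop_powr (relative_bop A B) (- \<nu>) * bop_powr A (- (1 / 2))"
proof -
  have q: "bop_powr (relative_bop A B) s * (bop_powr (relative_bop A B) (- s) * Y) = Y" for s Y
    using bop_powr_minus[OF posdef_relative, of s] by (simp flip: mult.assoc)
  show ?thesis unfolding gmean_relative
    using q[of \<nu>] q[of "- \<nu>"] by (intro bop_inv_eqI) (simp_all add: mult.assoc half_powers[OF A])
qed

lemma bop_inv_relative:
  "bop_inv B = bop_powr A (- (1 / 2)) * bop_powr (relative_bop A B) (- 1) * bop_powr A (- (1 / 2))"
proof -
  have "A \<sharp>\<^bsub>1\<^esub> B = B"
    by (simp add: gmean_relative bop_powr_one posdef_relative)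
      (simp add: relative_bop_def mult.assoc half_powers[OF A])
  then show ?thesis using bop_inv_gmean[of 1] by simp
qed

lemma gmean_bop_inv: "bop_inv A \<sharp>\<^bsub>\<nu>\<^esub> bop_inv B = bop_inv (A \<sharp>\<^bsub>\<nu>\<^esub> B)"
proof -
  have p: "bop_powr (bop_inv A) (1 / 2) = bop_powr A (- (1 / 2))"
    "bop_powr (bop_inv A) (- (1 / 2)) = bop_powr A (1 / 2)"
    by (simp_all add: bop_inv_eq_powr A bop_powr_powr)
  have "relative_bop (bop_inv A) (bop_inv B) = bop_powr (relative_bop A B) (- 1)"
    unfolding relative_bop_def[of "bop_inv A"] p bop_inv_relative by (simp add: mult.assoc half_powers[OF A])
  then show ?thesis
    unfolding gmean_relative[of "bop_inv A"] p bop_inv_gmean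
    by (simp add: bop_powr_powr posdef_relative)
qed

lemma relative_le:
  assumes "c > 0" "d > 0" "d *\<^sub>R 1 \<le> A" "B \<le> c *\<^sub>R 1"
  shows "relative_bop A B \<le> (c / d) *\<^sub>R 1"
proof -
  let ?C = "bop_powr A (- (1 / 2))"
  have C: "selfadjoint ?C" by (rule selfadjoint_bop_powr[OF A])
  have "d *\<^sub>R (?C * ?C) \<le> 1"
    using sandwich_mono[OF C assms(3)] sandwich_half_inverse[OF A] by simp
  then have "(c / d) *\<^sub>R (d *\<^sub>R (?C * ?C)) \<le> (c / d) *\<^sub>R 1"
    using assms by (intro scaleR_left_mono) auto
  then have "c *\<^sub>R (?C * ?C) \<le> (c / d) *\<^sub>R 1" using assms by simp
  moreover have "relative_bop A B \<le> c *\<^sub>R (?C * ?C)"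
    using sandwich_mono[OF C assms(4)] by (simp add: relative_bop_def)
  ultimately show ?thesis by simp
qed

lemma relative_ge:
  assumes "c > 0" "d > 0" "A \<le> d *\<^sub>R 1" "c *\<^sub>R 1 \<le> B"
  shows "(c / d) *\<^sub>R 1 \<le> relative_bop A B"
proof -
  let ?C = "bop_powr A (- (1 / 2))"
  have C: "selfadjoint ?C" by (rule selfadjoint_bop_powr[OF A])
  have "1 \<le> d *\<^sub>R (?C * ?C)"
    using sandwich_mono[OF C assms(3)] sandwich_half_inverse[OF A] by simp
  then have "(c / d) *\<^sub>R 1 \<le> (c / d) *\<^sub>R (d *\<^sub>R (?C * ?C))"
    using assms by (intro scaleR_left_mono) auto
  then have "(c / d) *\<^sub>R 1 \<le> c *\<^sub>R (?C * ?C)" using assms by simp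
  moreover have "c *\<^sub>R (?C * ?C) \<le> relative_bop A B"
    using sandwich_mono[OF C assms(4)] by (simp add: relative_bop_def)
  ultimately show ?thesis by simp
qed

end

section \<open>From scalar to operator inequalities\<close>

text \<open>Four terms are what the refined Young inequality needs; shorter combinations are padded with
  coefficient \<open>0\<close>.\<close>

lemma powr_combination_nonneg:
  assumes a: "0 < a" and I: "spectral_interval T a b"
    and F: "\<And>t. t \<in> {a..b} \<Longrightarrow> 0 \<le> \<alpha> + \<beta> * t powr s + \<gamma> * t powr u + \<delta> * t powr v"
  shows "0 \<le> \<alpha> *\<^sub>R 1 + \<beta> *\<^sub>R bop_powr T s + \<gamma> *\<^sub>R bop_powr T u + \<delta> *\<^sub>R bop_powr T v"
proof -
  interpret spectral_interval T a b by (rule I)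
  have c: "continuous_on {a..b} (\<lambda>t. \<kappa> * t powr w)" for \<kappa> w
    by (intro continuous_on_mult_left continuous_on_powr_pos a)
  have "0 \<le> fun_calc (\<lambda>t. \<alpha> + \<beta> * t powr s + \<gamma> * t powr u + \<delta> * t powr v) T"
    by (intro calc_nonneg continuous_on_add continuous_on_const c F)
  also have "\<dots> = \<alpha> *\<^sub>R 1 + \<beta> *\<^sub>R bop_powr T s + \<gamma> *\<^sub>R bop_powr T u + \<delta> *\<^sub>R bop_powr T v"
    unfolding bop_powr_def
    by (simp add: calc_add calc_scaleR calc_const c continuous_on_add continuous_on_powr_pos[OF a])
  finally show ?thesis .
qed

lemma add_inverse_le:
  assumes m: "0 < m" "m < M" and A: "m *\<^sub>R 1 \<le> A" "A \<le> M *\<^sub>R (1 :: 'a::chilbert_space bop)"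
  shows "A + (M * m) *\<^sub>R bop_inv A \<le> (M + m) *\<^sub>R 1"
proof -
  have pA: "posdef A" using m A unfolding posdef_def by blast
  have I: "spectral_interval A m M" using m A by unfold_locales
  have "0 \<le> (M + m) *\<^sub>R 1 + (- 1) *\<^sub>R bop_powr A 1 + (- (M * m)) *\<^sub>R bop_powr A (- 1) + 0 *\<^sub>R bop_powr A 0"
  proof (rule powr_combination_nonneg[OF m(1) I])
    fix t assume t: "t \<in> {m..M}"
    then have "0 \<le> (M - t) * (t - m) / t" using m by simp
    also have "\<dots> = (M + m) - t - M * m / t" using t m by (simp add: field_simps)
    finally show "0 \<le> M + m + - 1 * t powr 1 + - (M * m) * t powr - 1 + 0 * t powr 0"
      using t m by (simp add: powr_minus_divide)
  qed
  then show ?thesis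
    by (simp add: bop_powr_one pA bop_inv_eq_powr algebra_simps)
qed

lemma gmean_bop_inv_le_amean:
  assumes A: "posdef (A :: 'a::chilbert_space bop)" and B: "posdef B"
  shows "0 \<le> bop_inv A \<nabla>\<^bsub>1/2\<^esub> bop_inv B - bop_inv A \<sharp>\<^bsub>1/2\<^esub> bop_inv B"
proof -
  let ?T = "relative_bop A B" and ?C = "bop_powr A (- (1 / 2))"
  obtain a b where a: "0 < a" and I: "spectral_interval ?T a b"
    using posdef_interval posdef_relative[OF A B] by blast
  have "0 \<le> (1 / 2) *\<^sub>R 1 + (1 / 2) *\<^sub>R bop_powr ?T (- 1) + (- 1) *\<^sub>R bop_powr ?T (- (1 / 2)) + 0 *\<^sub>R bop_powr ?T 0"
  proof (rule powr_combination_nonneg[OF a I])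
    fix t assume "t \<in> {a..b}"
    then have t: "0 < t" using a by simp
    define u where "u = t powr (- (1 / 2))"
    have "t powr (- 1) = u\<^sup>2" using t by (simp add: u_def power2_eq_square powr_add[symmetric])
    moreover have "0 \<le> (1 - u)\<^sup>2" by simp
    ultimately show "0 \<le> 1 / 2 + 1 / 2 * t powr - 1 + - 1 * t powr - (1 / 2) + 0 * t powr 0"
      unfolding u_def[symmetric] by (simp add: power2_diff)
  qed
  from sandwich_mono[OF selfadjoint_bop_powr[OF A] this, of "- (1 / 2)"]
  have "0 \<le> ?C * ((1 / 2) *\<^sub>R 1 + (1 / 2) *\<^sub>R bop_powr ?T (- 1) + (- 1) *\<^sub>R bop_powr ?T (- (1 / 2))) * ?C"
    by simp
  also have "\<dots> = (1 / 2) *\<^sub>R (?C * ?C) + (1 / 2) *\<^sub>R (?C * bop_powr ?T (- 1) * ?C) - ?C * bop_powr ?T (- (1 / 2)) * ?C"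
    by (simp add: distrib_left distrib_right left_diff_distrib right_diff_distrib)
  also have "?C * ?C = bop_inv A" by (simp add: bop_powr_add bop_inv_eq_powr A)
  finally show ?thesis
    unfolding bop_inv_relative[OF A B, symmetric]
    by (simp add: amean_def gmean_bop_inv[OF A B] bop_inv_gmean[OF A B])
qed

text \<open>The scalar inequality is used on an interval that contains the spectrum of the relative operator
  \<open>T\<close> and lies on one side of the gap. It gives an inequality between powers of \<open>T\<close>, which is then
  multiplied by \<open>A\<^sup>-\<^sup>1\<^sup>/\<^sup>2\<close> on both sides.\<close>

lemma refined_Young_bop:
  assumes A: "posdef (A :: 'a::chilbert_space bop)" and B: "posdef B"
    and h: "1 \<le> h" "relative_bop A B \<le> (1 / h) *\<^sub>R 1 \<or> h *\<^sub>R 1 \<le> relative_bop A B"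
    and \<nu>: "0 \<le> \<nu>" "\<nu> \<le> 1"
    and r: "r = min \<nu> (1 - \<nu>)" and r1: "r1 = min (2 * r) (1 - 2 * r)"
  shows "(kantorovich (sqrt h) powr r1) *\<^sub>R bop_inv (A \<sharp>\<^bsub>\<nu>\<^esub> B)
      + (2 * r) *\<^sub>R (bop_inv A \<nabla>\<^bsub>1/2\<^esub> bop_inv B - bop_inv A \<sharp>\<^bsub>1/2\<^esub> bop_inv B)
    \<le> (1 - \<nu>) *\<^sub>R bop_inv A + \<nu> *\<^sub>R bop_inv B"
proof -
  let ?T = "relative_bop A B" and ?C = "bop_powr A (- (1 / 2))" and ?k = "kantorovich (sqrt h) powr r1"
  note T = posdef_relative[OF A B]
  obtain a b where a: "0 < a" and I: "spectral_interval ?T a b"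
    and gap: "\<And>t. t \<in> {a..b} \<Longrightarrow> t \<le> 1 / h \<or> h \<le> t"
    using h(2)
  proof
    assume le: "?T \<le> (1 / h) *\<^sub>R 1"
    obtain d where d: "0 < d" "d *\<^sub>R 1 \<le> ?T" using T unfolding posdef_def by blast
    define a where "a = min d (1 / (2 * h))"
    have "a *\<^sub>R 1 \<le> ?T" using d(2) scaleR_one_mono[of a d] by (auto simp: a_def intro: order_trans)
    moreover have "0 < a" "a < 1 / h" using d h(1) by (auto simp: a_def min_def field_simps)
    ultimately show ?thesis using that[of a "1 / h"] le by (auto simp: spectral_interval_def)
  next
    assume ge: "h *\<^sub>R 1 \<le> ?T"
    have "?T \<le> norm ?T *\<^sub>R 1" by (intro selfadjoint_le_norm posdef_selfadjoint T)
    also have "\<dots> \<le> (h + norm ?T + 1) *\<^sub>R 1" using h(1) by (intro scaleR_one_mono) auto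
    finally show ?thesis
      using that[of h "h + norm ?T + 1"] ge h(1) by (auto simp: spectral_interval_def add_nonneg_pos add.assoc)
  qed
  have "0 \<le> (1 - \<nu> - r) *\<^sub>R 1 + (\<nu> - r) *\<^sub>R bop_powr ?T (- 1) + (- ?k) *\<^sub>R bop_powr ?T (- \<nu>)
      + (2 * r) *\<^sub>R bop_powr ?T (- (1 / 2))"
    using a gap by (intro powr_combination_nonneg[OF a I] refined_Young_powr h(1) \<nu> r r1) auto
  from sandwich_mono[OF selfadjoint_bop_powr[OF A] this, of "- (1 / 2)"]
  have "0 \<le> ?C * ((1 - \<nu> - r) *\<^sub>R 1 + (\<nu> - r) *\<^sub>R bop_powr ?T (- 1) + (- ?k) *\<^sub>R bop_powr ?T (- \<nu>)
      + (2 * r) *\<^sub>R bop_powr ?T (- (1 / 2))) * ?C"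
    by simp
  also have "\<dots> = (1 - \<nu> - r) *\<^sub>R (?C * ?C) + (\<nu> - r) *\<^sub>R (?C * bop_powr ?T (- 1) * ?C)
      - ?k *\<^sub>R (?C * bop_powr ?T (- \<nu>) * ?C) + (2 * r) *\<^sub>R (?C * bop_powr ?T (- (1 / 2)) * ?C)"
    by (simp add: distrib_left distrib_right left_diff_distrib right_diff_distrib)
  also have "?C * ?C = bop_inv A" by (simp add: bop_powr_add bop_inv_eq_powr A)
  also have "?C * bop_powr ?T (- 1) * ?C = bop_inv B" by (rule bop_inv_relative[OF A B, symmetric])
  also have "?C * bop_powr ?T (- \<nu>) * ?C = bop_inv (A \<sharp>\<^bsub>\<nu>\<^esub> B)" by (rule bop_inv_gmean[OF A B, symmetric])
  also have "?C * bop_powr ?T (- (1 / 2)) * ?C = bop_inv A \<sharp>\<^bsub>1/2\<^esub> bop_inv B"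
    by (simp add: gmean_bop_inv A B bop_inv_gmean)
  also have "(1 - \<nu> - r) *\<^sub>R bop_inv A + (\<nu> - r) *\<^sub>R bop_inv B - ?k *\<^sub>R bop_inv (A \<sharp>\<^bsub>\<nu>\<^esub> B)
      + (2 * r) *\<^sub>R (bop_inv A \<sharp>\<^bsub>1/2\<^esub> bop_inv B)
    = ((1 - \<nu>) *\<^sub>R bop_inv A + \<nu> *\<^sub>R bop_inv B) - (?k *\<^sub>R bop_inv (A \<sharp>\<^bsub>\<nu>\<^esub> B)
      + (2 * r) *\<^sub>R (bop_inv A \<nabla>\<^bsub>1/2\<^esub> bop_inv B - bop_inv A \<sharp>\<^bsub>1/2\<^esub> bop_inv B))"
  proof -
    have "(2 * r) *\<^sub>R (bop_inv A \<nabla>\<^bsub>1/2\<^esub> bop_inv B) = r *\<^sub>R bop_inv A + r *\<^sub>R bop_inv B"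
      by (simp add: amean_def scaleR_add_right)
    then show ?thesis by (simp add: scaleR_diff_right scaleR_diff_left)
  qed
  finally show ?thesis by simp
qed

section \<open>Positive maps and means\<close>

text \<open>Ando's inequality. Conjugating \<open>\<Phi>\<close> by \<open>A\<^sup>1\<^sup>/\<^sup>2\<close> inside and \<open>\<Phi>(A)\<^sup>-\<^sup>1\<^sup>/\<^sup>2\<close> outside gives a unital positive map
  \<open>\<Psi>\<close> that sends the relative operator of \<open>A\<close> and \<open>B\<close> to that of \<open>\<Phi>(A)\<close> and \<open>\<Phi>(B)\<close>. The claim is
  concavity of the power under \<open>\<Psi>\<close>.\<close>

lemma (in unital_positive_map) map_gmean_le:
  assumes A: "posdef A" and B: "posdef B" and \<nu>: "0 \<le> \<nu>" "\<nu> \<le> 1"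
  shows "\<Phi> (A \<sharp>\<^bsub>\<nu>\<^esub> B) \<le> \<Phi> A \<sharp>\<^bsub>\<nu>\<^esub> \<Phi> B"
proof -
  let ?C = "bop_powr A (1 / 2)" and ?D = "bop_powr (\<Phi> A) (- (1 / 2))" and ?E = "bop_powr (\<Phi> A) (1 / 2)"
  note PA = posdef_map[OF A] and PB = posdef_map[OF B]
  define \<Psi> where "\<Psi> Y = ?D * \<Phi> (?C * Y * ?C) * ?D" for Y
  have CC: "?C * ?C = A" by (simp add: bop_powr_add A bop_powr_one)
  interpret \<Psi>: unital_positive_map \<Psi>
  proof
    show "\<Psi> (X + Y) = \<Psi> X + \<Psi> Y" for X Y
      by (simp add: \<Psi>_def distrib_left distrib_right add)
    show "\<Psi> (c *\<^sub>R X) = c *\<^sub>R \<Psi> X" for c X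
      by (simp add: \<Psi>_def scaleR)
    show "0 \<le> \<Psi> X" if "0 \<le> X" for X
      using sandwich_mono[OF selfadjoint_bop_powr[OF PA, of "- (1 / 2)"] positive[of "?C * X * ?C"]]
        sandwich_mono[OF selfadjoint_bop_powr[OF A, of "1 / 2"] that] by (simp add: \<Psi>_def)
    show "\<Psi> 1 = 1"
      by (simp add: \<Psi>_def CC sandwich_half_inverse PA)
  qed
  have EPE: "?E * \<Psi> Y * ?E = \<Phi> (?C * Y * ?C)" for Y
    unfolding \<Psi>_def by (simp add: mult.assoc half_powers[OF PA])
  let ?T = "relative_bop A B"
  have "\<Psi> ?T = relative_bop (\<Phi> A) (\<Phi> B)"
  proof -
    have "?C * ?T * ?C = B"
      unfolding relative_bop_def by (simp add: mult.assoc half_powers[OF A])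
    then show ?thesis by (simp add: \<Psi>_def relative_bop_def)
  qed
  then have "\<Psi> (bop_powr ?T \<nu>) \<le> bop_powr (relative_bop (\<Phi> A) (\<Phi> B)) \<nu>"
    using \<Psi>.map_powr_le[OF posdef_relative[OF A B] \<nu>] by simp
  from sandwich_mono[OF selfadjoint_bop_powr[OF PA, of "1 / 2"] this] show ?thesis
    by (simp add: EPE gmean_relative)
qed

text \<open>The estimate common to both inequalities of the theorem, which correspond to two choices of \<open>Z\<close>.\<close>

lemma (in unital_positive_map) square_map_le:
  assumes m: "0 < m" "m < M"
    and A: "m *\<^sub>R 1 \<le> A" "A \<le> M *\<^sub>R 1" and B: "m *\<^sub>R 1 \<le> B" "B \<le> M *\<^sub>R 1"
    and h: "1 \<le> h" "relative_bop A B \<le> (1 / h) *\<^sub>R 1 \<or> h *\<^sub>R 1 \<le> relative_bop A B"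
    and \<nu>: "0 \<le> \<nu>" "\<nu> \<le> 1"
    and r: "r = min \<nu> (1 - \<nu>)" and r1: "r1 = min (2 * r) (1 - 2 * r)"
    and Z: "\<Phi> (A \<sharp>\<^bsub>\<nu>\<^esub> B) \<le> Z"
  shows "(\<Phi> (A \<nabla>\<^bsub>\<nu>\<^esub> B + (2 * r * M * m) *\<^sub>R
      (bop_inv A \<nabla>\<^bsub>1/2\<^esub> bop_inv B - bop_inv A \<sharp>\<^bsub>1/2\<^esub> bop_inv B)))\<^sup>2
    \<le> (kantorovich (M / m) / kantorovich (sqrt h) powr r1)\<^sup>2 *\<^sub>R Z\<^sup>2"
proof -
  let ?H = "bop_inv A \<nabla>\<^bsub>1/2\<^esub> bop_inv B - bop_inv A \<sharp>\<^bsub>1/2\<^esub> bop_inv B"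
  let ?X = "A \<nabla>\<^bsub>\<nu>\<^esub> B + (2 * r * M * m) *\<^sub>R ?H"
  let ?G = "A \<sharp>\<^bsub>\<nu>\<^esub> B"
  define k where "k = kantorovich (sqrt h) powr r1"
  have pA: "posdef A" and pB: "posdef B" using m A B unfolding posdef_def by blast+
  have G: "posdef ?G" by (rule posdef_gmean[OF pA pB])
  have pZ: "posdef Z" using posdef_mono[OF posdef_map[OF G] Z] .
  have Mm: "0 < M * m" using m by simp
  have k: "0 < k" using kantorovich_pos[of "sqrt h"] h(1) by (simp add: k_def)
  have r0: "0 \<le> r" using r \<nu> by simp
  have H: "0 \<le> ?H" by (rule gmean_bop_inv_le_amean[OF pA pB])
  have X: "0 \<le> ?X"
    using H r0 m \<nu> posdef_nonneg[OF pA] posdef_nonneg[OF pB] unfolding amean_def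
    by (intro add_nonneg_nonneg scaleR_nonneg_nonneg) auto
  have "?X + (M * m * k) *\<^sub>R bop_inv ?G
      = A \<nabla>\<^bsub>\<nu>\<^esub> B + (M * m) *\<^sub>R (k *\<^sub>R bop_inv ?G + (2 * r) *\<^sub>R ?H)"
    by (simp add: scaleR_add_right ac_simps)
  also have "\<dots> \<le> A \<nabla>\<^bsub>\<nu>\<^esub> B + (M * m) *\<^sub>R ((1 - \<nu>) *\<^sub>R bop_inv A + \<nu> *\<^sub>R bop_inv B)"
    unfolding k_def
    by (rule add_left_mono[OF scaleR_left_mono[OF refined_Young_bop[OF pA pB h \<nu> r r1]]]) (use Mm in simp)
  also have "\<dots> = (1 - \<nu>) *\<^sub>R (A + (M * m) *\<^sub>R bop_inv A) + \<nu> *\<^sub>R (B + (M * m) *\<^sub>R bop_inv B)"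
    by (simp add: amean_def scaleR_add_right ac_simps)
  also have "\<dots> \<le> (1 - \<nu>) *\<^sub>R ((M + m) *\<^sub>R 1) + \<nu> *\<^sub>R ((M + m) *\<^sub>R 1)"
    using \<nu> by (intro add_mono scaleR_left_mono add_inverse_le m A B) auto
  also have "\<dots> = (M + m) *\<^sub>R 1"
    by (simp only: scaleR_add_left[symmetric]) simp
  finally have "\<Phi> (?X + (M * m * k) *\<^sub>R bop_inv ?G) \<le> \<Phi> ((M + m) *\<^sub>R 1)"
    by (rule mono)
  then have 1: "\<Phi> ?X + (M * m * k) *\<^sub>R \<Phi> (bop_inv ?G) \<le> (M + m) *\<^sub>R 1"
    unfolding add scaleR unital .
  have "\<Phi> ?X + (M * m * k) *\<^sub>R bop_inv Z \<le> \<Phi> ?X + (M * m * k) *\<^sub>R \<Phi> (bop_inv ?G)"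
    using Mm k by (intro add_left_mono scaleR_left_mono bop_inv_map_le G Z) auto
  then have le: "\<Phi> ?X + (M * m * k) *\<^sub>R bop_inv Z \<le> (M + m) *\<^sub>R 1"
    using 1 by (rule order_trans)
  have "\<Phi> ?X * \<Phi> ?X \<le> ((M + m)\<^sup>2 / (4 * (M * m * k)))\<^sup>2 *\<^sub>R (Z * Z)"
    by (rule square_le_if_sum_le[OF positive[OF X] posdef_selfadjoint[OF pZ] posdef_nonneg[OF posdef_bop_inv[OF pZ]]
          bop_inv_right[OF pZ] bop_inv_left[OF pZ] _ le]) (use Mm k in simp)
  moreover have "(M + m)\<^sup>2 / (4 * (M * m * k)) = kantorovich (M / m) / k"
    using m k by (simp add: kantorovich_def field_simps power2_eq_square)
  ultimately show ?thesis unfolding k_def power2_eq_square[of "\<Phi> ?X"] power2_eq_square[of Z] by simp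
qed

text \<open>On the zero space \<open>0 = 1\<close>, and operator inequalities say nothing about scalars.\<close>

lemma scaleR_one_le_cancel:
  assumes "(1 :: 'a::complex_inner bop) \<noteq> 0" "c *\<^sub>R 1 \<le> d *\<^sub>R (1 :: 'a bop)"
  shows "c \<le> d"
proof (rule ccontr)
  assume "\<not> c \<le> d"
  then have "d *\<^sub>R (1 :: 'a bop) \<le> c *\<^sub>R 1" by (intro scaleR_one_mono) simp
  then have "c *\<^sub>R (1 :: 'a bop) = d *\<^sub>R 1" using assms(2) by (intro antisym)
  then show False using assms(1) \<open>\<not> c \<le> d\<close> by simp
qed

theorem theorem2p4:
  fixes A B :: "'a::chilbert_space bop"
    and \<Phi> :: "'a bop \<Rightarrow> 'b::chilbert_space bop"
    and m m' M M' h h' \<nu> r r\<^sub>1 :: real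
  assumes "0 \<le> A" and "0 \<le> B"
    and "0 < m" and "0 < m'" and "0 < M" and "0 < M'"
    and "(m *\<^sub>R 1 \<le> B \<and> B \<le> m' *\<^sub>R 1 \<and> m' < M' \<and> M' *\<^sub>R 1 \<le> A \<and> A \<le> M *\<^sub>R 1) \<or>
         (m *\<^sub>R 1 \<le> A \<and> A \<le> m' *\<^sub>R 1 \<and> m' < M' \<and> M' *\<^sub>R 1 \<le> B \<and> B \<le> M *\<^sub>R 1)"
    and "clinear \<Phi>" and "positive_map \<Phi>" and "unital \<Phi>"
    and "0 \<le> \<nu>" and "\<nu> \<le> 1"
    and "r = min \<nu> (1 - \<nu>)" and "r\<^sub>1 = min (2 * r) (1 - 2 * r)"
    and "h = M / m" and "h' = M' / m'"
  shows "(\<Phi> (A \<nabla>\<^bsub>\<nu>\<^esub> B + (2 * r * M * m) *\<^sub>R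
            (bop_inv A \<nabla>\<^bsub>1/2\<^esub> bop_inv B - bop_inv A \<sharp>\<^bsub>1/2\<^esub> bop_inv B)))\<^sup>2
         \<le> (kantorovich h / kantorovich (sqrt h') powr r\<^sub>1)\<^sup>2 *\<^sub>R (\<Phi> (A \<sharp>\<^bsub>\<nu>\<^esub> B))\<^sup>2 \<and>
         (\<Phi> (A \<nabla>\<^bsub>\<nu>\<^esub> B + (2 * r * M * m) *\<^sub>R
            (bop_inv A \<nabla>\<^bsub>1/2\<^esub> bop_inv B - bop_inv A \<sharp>\<^bsub>1/2\<^esub> bop_inv B)))\<^sup>2
         \<le> (kantorovich h / kantorovich (sqrt h') powr r\<^sub>1)\<^sup>2 *\<^sub>R (\<Phi> A \<sharp>\<^bsub>\<nu>\<^esub> \<Phi> B)\<^sup>2"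
proof (cases "(1 :: 'b bop) = 0")
  case True
  \<comment> \<open>on the zero space there is only one operator\<close>
  have "S = T" for S T :: "'b bop"
    by (metis True mult_1_left mult_zero_left)
  then show ?thesis by (metis order_refl)
next
  case False
  interpret unital_positive_map \<Phi>
  proof
    show "\<Phi> (c *\<^sub>R X) = c *\<^sub>R \<Phi> X" for c X
      using assms(8) by (simp add: clinear_iff flip: scaleC_of_real)
  qed (use assms in \<open>auto simp: clinear_iff positive_map_def unital_def\<close>)
  have 1: "(1 :: 'a bop) \<noteq> 0" using False unital zero by metis
  have o: "m \<le> m'" "m' < M'" "M' \<le> M"
    using assms(7) by (auto intro!: scaleR_one_le_cancel[OF 1] intro: order_trans)
  have m: "m < M" using o by simp
  have "m *\<^sub>R 1 \<le> M' *\<^sub>R (1 :: 'a bop)" "m' *\<^sub>R 1 \<le> M *\<^sub>R (1 :: 'a bop)"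
    using o by (intro scaleR_one_mono; simp)+
  then have A: "m *\<^sub>R 1 \<le> A" "A \<le> M *\<^sub>R 1" and B: "m *\<^sub>R 1 \<le> B" "B \<le> M *\<^sub>R 1"
    using assms(7) by (auto intro: order_trans)
  have pA: "posdef A" and pB: "posdef B" using \<open>0 < m\<close> A B unfolding posdef_def by blast+
  have h: "1 \<le> h'" using o assms(4) by (simp add: assms(16))
  have rel: "relative_bop A B \<le> (1 / h') *\<^sub>R 1 \<or> h' *\<^sub>R 1 \<le> relative_bop A B"
    using assms(7)
  proof
    assume "m *\<^sub>R 1 \<le> B \<and> B \<le> m' *\<^sub>R 1 \<and> m' < M' \<and> M' *\<^sub>R 1 \<le> A \<and> A \<le> M *\<^sub>R 1"
    then show ?thesis using relative_le[OF pA pB assms(4,6)] by (simp add: assms(16))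
  next
    assume "m *\<^sub>R 1 \<le> A \<and> A \<le> m' *\<^sub>R 1 \<and> m' < M' \<and> M' *\<^sub>R 1 \<le> B \<and> B \<le> M *\<^sub>R 1"
    then show ?thesis using relative_ge[OF pA pB assms(6,4)] by (simp add: assms(16))
  qed
  note le = square_map_le[OF assms(3) m A B h rel assms(11-14)]
  show ?thesis
    unfolding assms(15)
    by (intro conjI le order_refl map_gmean_le pA pB assms(11,12))
qed

end
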